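(* Let $n\ge 2$, let $\mu$ be a rotationally invariant Radon measure on $\mathbb{R}^n$ and let $k\in\{1,\ldots,n\}$. If $u_{k+1},\ldots,u_n\in\mathrm{Conv}(\mathbb{R}^n)$ are radially symmetric such that \[ 0<p_{u_{k+1}},\ldots,p_{u_n}<\infty\qquad \text{on } (0,\infty), \] then there exists a unique radially symmetric $u\in\mathrm{Conv}(\mathbb{R}^n)$ solving the problem \[ \begin{cases} \mathrm{MA}(u[k],u_{k+1},\ldots,u_n;\cdot)=\mu &\text{ in } \mathbb{R}^n, \\ u(o)=0, \end{cases} \] if and only if \[ r\mapsto F_\mu(r)= \frac{\mu(D_r^n)}{p_{u_{k+1}}(r)\cdots p_{u_n}(r)},\quad r>0, \] is non-decreasing. In this case, $u$ is given by \[ u(x) = \int_{0}^{|x|} \left( \tfrac{1}{\kappa_n}F_\mu(t)\right)^{\frac 1k} \,\mathrm{d} t \] for $x\in\mathbb{R}^n$.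
   Context: $D_r^n=\{x\in\mathbb{R}^n:|x|<r\}$ is the open Euclidean ball of radius $r$ centered at the origin $o$, and $\kappa_n$ is the volume of the unit ball in $\mathbb{R}^n$. A Radon measure is a Borel measure that is finite on compact sets. A measure $\mu$ on $\mathbb{R}^n$ is rotationally invariant if $\mu(\vartheta B)=\mu(B)$ for every $\vartheta\in\mathrm{SO}(n)$ and every Borel $B\subseteq\mathbb{R}^n$. A function is radially symmetric if its value at $x$ depends only on $|x|$. $\mathrm{Conv}(\mathbb{R}^n)$ is the set of finite-valued convex functions $u\colon\mathbb{R}^n\to\mathbb{R}$, and $\partial u(x)=\{p\in\mathbb{R}^n: u(z)\ge u(x)+\langle p,z-x\rangle\ \text{for all } z\in\mathbb{R}^n\}$ is the subdifferential. For radially symmetric $v\in\mathrm{Conv}(\mathbb{R}^n)$ and $r>0$, \[ p_v(r)=\sup\{|p|:p\in\partial v(x),\ 0\le|x|<r\}. \] The Monge--Ampère measure of $u\in\mathrm{Conv}(\mathbb{R}^n)$ is $\mathrm{MA}(u;B)=\mathrm{vol}_n\big(\bigcup_{x\in B}\partial u(x)\big)$ for Borel $B\subseteq\mathbb{R}^n$. The mixed Monge--Ampère measure assigns to $u_1,\ldots,u_n\in\mathrm{Conv}(\mathbb{R}^n)$ the unique Radon measure $\mathrm{MA}(u_1,\ldots,u_n;\cdot)$ on $\mathbb{R}^n$ that is symmetric in its entries and satisfies \[ \mathrm{MA}(\lambda_1u_1+\cdots+\lambda_mu_m;B)=\sum_{i_1,\ldots,i_n=1}^m\lambda_{i_1}\cdots\lambda_{i_n}\mathrm{MA}(u_{i_1},\ldots,u_{i_n};B)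 \] for all $m\in\mathbb{N}$, $u_1,\ldots,u_m\in\mathrm{Conv}(\mathbb{R}^n)$, $\lambda_1,\ldots,\lambda_m\ge0$ and Borel $B\subseteq\mathbb{R}^n$. The notation $u[k]$ means that the entry $u$ is repeated $k$ times. For $k=n$ there are no functions $u_{k+1},\ldots,u_n$ and $F_\mu(r)=\mu(D_r^n)$. *)

theory Defs
  imports "HOL-Analysis.Analysis"
begin

definition Conv :: "(real^'n \<Rightarrow> real) set" where
  "Conv = {u. convex_on UNIV u}"

definition radially_symmetric :: "(real^'n \<Rightarrow> 'b) \<Rightarrow> bool" where
  "radially_symmetric u \<longleftrightarrow> (\<forall>x y. norm x = norm y \<longrightarrow> u x = u y)"

definition subdifferential :: "(real^'n \<Rightarrow> real) \<Rightarrow> real^'n \<Rightarrow> (real^'n) set" where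
  "subdifferential u x = {p. \<forall>z. u z \<ge> u x + p \<bullet> (z - x)}"

(* The supremum is taken in [0,\<infinity>], so that finiteness is a genuine condition. *)
definition psup :: "(real^'n \<Rightarrow> real) \<Rightarrow> real \<Rightarrow> ennreal" where
  "psup v r = Sup {ennreal (norm p) | p x. norm x < r \<and> p \<in> subdifferential v x}"

definition Radon_measure :: "(real^'n) measure \<Rightarrow> bool" where
  "Radon_measure \<mu> \<longleftrightarrow> sets \<mu> = sets borel \<and> (\<forall>K. compact K \<longrightarrow> emeasure \<mu> K < \<infinity>)"

definition rotationally_invariant :: "(real^'n) measure \<Rightarrow> bool" where
  "rotationally_invariant \<mu> \<longleftrightarrow>
     (\<forall>Q. rotation_matrix Q \<longrightarrow>
        (\<forall>B\<in>sets borel. emeasure \<mu> ((*v) Q ` B) = emeasure \<mu> B))"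

(* For a Borel set B, the union below is Lebesgue measurable but not Borel in general. *)
definition MA :: "(real^'n \<Rightarrow> real) \<Rightarrow> (real^'n) set \<Rightarrow> ennreal" where
  "MA u B = emeasure lebesgue (\<Union>x\<in>B. subdifferential u x)"

(* The characterization of the mixed Monge-Ampere measure, with all entries taken from the
   set U of functions.  The n entries form a list of length n = CARD('n), and the multi-indices
   (i_1,...,i_n) are the lists of length n over {1..m}. *)
definition mixed_MA_on ::
    "(real^'n \<Rightarrow> real) set \<Rightarrow> ((real^'n \<Rightarrow> real) list \<Rightarrow> (real^'n) measure) \<Rightarrow> bool" where
  "mixed_MA_on U M \<longleftrightarrow>
     (\<forall>us. set us \<subseteq> U \<and> length us = CARD('n) \<longrightarrow> Radon_measure (M us)) \<and>
     (\<forall>us vs. set us \<subseteq> U \<and> length us = CARD('n) \<and> mset vs = mset us \<longrightarrow> M vs = M us) \<and>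
     (\<forall>(m::nat) w l. (\<forall>i\<in>{1..m}. w i \<in> U \<and> (0::real) \<le> l i) \<longrightarrow>
        (\<forall>B\<in>sets borel.
           MA (\<lambda>x. \<Sum>i=1..m. l i * w i x) B =
           (\<Sum>is | set is \<subseteq> {1..m} \<and> length is = CARD('n).
              ennreal (\<Prod>i\<leftarrow>is. l i) * emeasure (M (map w is)) B)))"

(* It suffices to impose the characterization on the functions occurring in us: this already
   determines the value at us, and it is the value at us of the family that satisfies the
   characterization on all of Conv (see mixed_MA_eq_global below). *)
definition mixed_MA :: "(real^'n \<Rightarrow> real) list \<Rightarrow> (real^'n) measure" where
  "mixed_MA us = (THE \<nu>. \<exists>M. mixed_MA_on (set us) M \<and> \<nu> = M us)"

definition solves :: "nat \<Rightarrow> (real^'n \<Rightarrow> real) list \<Rightarrow> (real^'n) measure \<Rightarrow> (real^'n \<Rightarrow> real) \<Rightarrow> bool" where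
  "solves k us \<mu> u \<longleftrightarrow>
     u \<in> Conv \<and> radially_symmetric u \<and> mixed_MA (replicate k u @ us) = \<mu> \<and> u 0 = 0"

definition F :: "(real^'n) measure \<Rightarrow> (real^'n \<Rightarrow> real) list \<Rightarrow> real \<Rightarrow> ennreal" where
  "F \<mu> us r = emeasure \<mu> (ball 0 r) / (\<Prod>v\<leftarrow>us. psup v r)"

lemma mixed_MA_on_mono: "mixed_MA_on U M \<Longrightarrow> V \<subseteq> U \<Longrightarrow> mixed_MA_on V M"
  unfolding mixed_MA_on_def by (blast dest: subset_trans)

lemma multi_index_sum_determined:
  fixes a b :: "nat list \<Rightarrow> ennreal"
  assumes "finite I"
    and fin: "\<And>is. set is \<subseteq> I \<Longrightarrow> length is = n \<Longrightarrow> a is < \<infinity>"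
    and eq: "\<And>J. J \<subseteq> I \<Longrightarrow> (\<Sum>is | set is \<subseteq> J \<and> length is = n. a is)
                           = (\<Sum>is | set is \<subseteq> J \<and> length is = n. b is)"
    and "J \<subseteq> I"
  shows "(\<Sum>is | set is = J \<and> length is = n. a is) = (\<Sum>is | set is = J \<and> length is = n. b is)"
proof -
  have "finite J" using assms finite_subset by blast
  then show ?thesis using \<open>J \<subseteq> I\<close>
  proof (induction J rule: finite_psubset_induct)
    case (psubset J)
    let ?S = "\<lambda>K. {is. set is = K \<and> length is = n}"
    let ?P = "Pow J - {J}"
    have finS: "finite (?S K)" if "K \<subseteq> I" for K
      by (rule finite_subset[OF _ finite_lists_length_eq[of I n]])
         (use that assms(1) in auto)
    have split: "(\<Sum>is | set is \<subseteq> J \<and> length is = n. c is)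
        = sum c (?S J) + (\<Sum>K\<in>?P. sum c (?S K))" for c :: "nat list \<Rightarrow> ennreal"
    proof -
      have "(\<Sum>is | set is \<subseteq> J \<and> length is = n. c is) = sum c (\<Union>K\<in>Pow J. ?S K)"
        by (rule sum.cong) auto
      also have "\<dots> = (\<Sum>K\<in>Pow J. sum c (?S K))"
        by (rule sum.UNION_disjoint) (use psubset finS in auto)
      also have "\<dots> = sum c (?S J) + (\<Sum>K\<in>?P. sum c (?S K))"
        using psubset(1) by (subst sum.remove[of _ J]) auto
      finally show ?thesis .
    qed
    have IH: "(\<Sum>K\<in>?P. sum a (?S K)) = (\<Sum>K\<in>?P. sum b (?S K))"
      by (rule sum.cong) (use psubset in auto)
    have "sum a (?S K) < top" if "K \<in> ?P" for K
      using that psubset(3) fin by (subst ennreal_sum_less_top) (auto intro!: finS)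
    then have top: "(\<Sum>K\<in>?P. sum a (?S K)) \<noteq> top"
      unfolding less_top using psubset(1) by (subst ennreal_sum_less_top) auto
    have "(\<Sum>K\<in>?P. sum a (?S K)) + sum a (?S J) = (\<Sum>K\<in>?P. sum a (?S K)) + sum b (?S J)"
      using split[of a] split[of b] eq[OF psubset(3)] unfolding IH by (simp only: add.commute)
    then show ?case
      using top by (simp add: ennreal_add_left_cancel)
  qed
qed

lemma mixed_MA_on_unique:
  fixes us :: "(real^'n \<Rightarrow> real) list"
  assumes M: "mixed_MA_on (set us) M" and M': "mixed_MA_on (set us) M'"
    and len: "length us = CARD('n)"
  shows "M us = M' us"
proof -
  define n where "n = CARD('n)"
  define w where "w i = us ! (i - 1)" for i
  have w: "w i \<in> set us" if "i \<in> {1..n}" for i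
    using that len by (auto simp: w_def n_def)
  have us: "us = map w [1..<Suc n]"
    by (rule nth_equalityI) (auto simp: w_def len n_def simp del: upt_Suc)
  have bounded_eq: "emeasure (M us) B = emeasure (M' us) B"
    if B: "B \<in> sets borel" "bounded B" for B
  proof -
    have sub: "set (map w is) \<subseteq> set us" if "set is \<subseteq> {1..n}" for "is"
      using that w by auto
    have fin: "emeasure (N (map w is)) B < \<infinity>"
      if N: "mixed_MA_on (set us) N" and "set is \<subseteq> {1..n}" "length is = n" for N "is"
    proof -
      have R: "Radon_measure (N (map w is))"
        using N sub[OF that(2)] that(3) unfolding mixed_MA_on_def n_def by simp
      have "emeasure (N (map w is)) B \<le> emeasure (N (map w is)) (closure B)"
        using R by (intro emeasure_mono closure_subset) (auto simp: Radon_measure_def)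
      also have "\<dots> < \<infinity>"
        using R B(2) by (auto simp: Radon_measure_def)
      finally show ?thesis .
    qed
    have expand: "(\<Sum>is | set is \<subseteq> J \<and> length is = n. emeasure (N (map w is)) B)
        = MA (\<lambda>x. \<Sum>i=1..n. (if i \<in> J then 1 else 0) * w i x) B"
      if N: "mixed_MA_on (set us) N" and J: "J \<subseteq> {1..n}" for N J
    proof -
      have *: "(\<Prod>i\<leftarrow>is. if i \<in> J then 1 else 0 :: real) = (if set is \<subseteq> J then 1 else 0)"
        for "is" by (induction "is") auto
      have "MA (\<lambda>x. \<Sum>i=1..n. (if i \<in> J then 1 else 0) * w i x) B
          = (\<Sum>is | set is \<subseteq> {1..n} \<and> length is = n.
              ennreal (\<Prod>i\<leftarrow>is. if i \<in> J then 1 else 0) * emeasure (N (map w is)) B)"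
        using N[unfolded mixed_MA_on_def, THEN conjunct2, THEN conjunct2, rule_format,
            of n w "\<lambda>i. if i \<in> J then 1 else 0" B] w B by (simp add: n_def)
      also have "\<dots> = (\<Sum>is | set is \<subseteq> J \<and> length is = n. emeasure (N (map w is)) B)"
        unfolding * using J
        by (intro sum.mono_neutral_cong_right finite_lists_length_eq) auto
      finally show ?thesis by simp
    qed
    let ?S = "{is. set is = {1..n} \<and> length is = n}"
    have mset: "mset (map w is) = mset us" if "is \<in> ?S" for "is"
    proof -
      have "distinct is"
        using that by (intro card_distinct) auto
      moreover have "set is = set [1..<Suc n]"
        using that unfolding set_upt atLeastLessThanSuc_atLeastAtMost by simp
      ultimately have "mset is = mset [1..<Suc n]"
        using set_eq_iff_mset_eq_distinct[OF _ distinct_upt] by blast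
      then have "mset (map w is) = mset (map w [1..<Suc n])"
        unfolding mset_map by (rule arg_cong)
      then show ?thesis by (subst us)
    qed
    have const: "(\<Sum>is\<in>?S. emeasure (N (map w is)) B) = of_nat (card ?S) * emeasure (N us) B"
      if N: "mixed_MA_on (set us) N" for N
    proof -
      have "N (map w is) = N us" if "is \<in> ?S" for "is"
        using N mset[OF that] len unfolding mixed_MA_on_def by blast
      then show ?thesis by simp
    qed
    have "finite ?S"
      by (rule finite_subset[OF _ finite_lists_length_eq[of "{1..n}" n]]) auto
    moreover have "[1..<Suc n] \<in> ?S" by auto
    ultimately have S: "card ?S \<noteq> 0" by (metis card_0_eq empty_iff)
    have "(\<Sum>is\<in>?S. emeasure (M (map w is)) B) = (\<Sum>is\<in>?S. emeasure (M' (map w is)) B)"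
      by (rule multi_index_sum_determined[where I = "{1..n}"])
         (simp_all add: fin[OF M, simplified] expand[OF M] expand[OF M'])
    then have "of_nat (card ?S) * emeasure (M us) B = of_nat (card ?S) * emeasure (M' us) B"
      by (simp only: const[OF M] const[OF M'])
    then show ?thesis
      using S by (simp add: ennreal_mult_cancel_left)
  qed
  have R: "Radon_measure (M us)" "Radon_measure (M' us)"
    using M M' len unfolding mixed_MA_on_def by simp_all
  show ?thesis
  proof (rule measure_eqI_generator_eq[where E = "{B \<in> sets borel. bounded B}"
        and \<Omega> = UNIV and A = "\<lambda>i. cball 0 (real i)"])
    show "Int_stable {B \<in> sets borel. bounded B}"
      by (auto simp: Int_stable_def)
    have "sets borel = sigma_sets UNIV {B :: (real^'n) set. B \<in> sets borel \<and> bounded B}"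
    proof
      show "sigma_sets UNIV {B :: (real^'n) set. B \<in> sets borel \<and> bounded B} \<subseteq> sets borel"
        using sets.sigma_sets_subset[of "{B :: (real^'n) set. B \<in> sets borel \<and> bounded B}" borel]
        by auto
      show "sets borel \<subseteq> sigma_sets UNIV {B :: (real^'n) set. B \<in> sets borel \<and> bounded B}"
      proof
        fix B :: "(real^'n) set" assume B: "B \<in> sets borel"
        have "B = (\<Union>i. B \<inter> cball 0 (real i))"
          by (auto intro: real_arch_simple)
        also have "\<dots> \<in> sigma_sets UNIV {B. B \<in> sets borel \<and> bounded B}"
          using B by (intro sigma_sets.Union sigma_sets.Basic) (auto intro: bounded_subset)
        finally show "B \<in> sigma_sets UNIV {B. B \<in> sets borel \<and> bounded B}" .
      qed
    qed
    then show "sets (M us) = sigma_sets UNIV {B \<in> sets borel. bounded B}"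
      and "sets (M' us) = sigma_sets UNIV {B \<in> sets borel. bounded B}"
      using R by (auto simp: Radon_measure_def)
    show "(\<Union>i. cball (0::real^'n) (real i)) = UNIV"
      by (auto intro: real_arch_simple)
    show "emeasure (M us) (cball 0 (real i)) \<noteq> \<infinity>" for i :: nat
      using R(1) unfolding Radon_measure_def using compact_cball by (metis less_irrefl)
    show "{B \<in> sets borel. bounded B} \<subseteq> Pow (UNIV :: (real^'n) set)" by simp
    show "range (\<lambda>i. cball (0::real^'n) (real i)) \<subseteq> {B \<in> sets borel. bounded B}"
      by (rule image_subsetI) simp
    show "emeasure (M us) B = emeasure (M' us) B" if "B \<in> {B \<in> sets borel. bounded B}" for B
      using that by (intro bounded_eq) simp_all
  qed
qed

lemma mixed_MA_eq:
  fixes us :: "(real^'n \<Rightarrow> real) list"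
  assumes "mixed_MA_on (set us) M" and "length us = CARD('n)"
  shows "mixed_MA us = M us"
  unfolding mixed_MA_def
proof (rule the_equality)
  show "\<exists>N. mixed_MA_on (set us) N \<and> M us = N us"
    using assms(1) by (intro exI[of _ M] conjI refl)
  show "\<nu> = M us" if "\<exists>N. mixed_MA_on (set us) N \<and> \<nu> = N us" for \<nu>
    using that mixed_MA_on_unique[OF _ assms] by (elim exE conjE) simp
qed

lemma mixed_MA_eq_global:
  fixes us :: "(real^'n \<Rightarrow> real) list"
  assumes "mixed_MA_on Conv M" and "set us \<subseteq> Conv" and "length us = CARD('n)"
  shows "mixed_MA us = M us"
  by (rule mixed_MA_eq[OF mixed_MA_on_mono[OF assms(1,2)] assms(3)])

end

theory Submission
  imports Defs
begin

text \<open>A radially symmetric convex \<open>v\<close> is determined, up to its value at the origin, by the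
  left-continuous nondecreasing function \<open>p\<^sub>v\<close>, which is the left derivative of its radial part
  and hence linear in \<open>v\<close>. Up to a null set, \<open>\<partial>v\<close> is inverted by the map sending \<open>q\<close> to the
  multiple of \<open>q / |q|\<close> whose length is the generalized inverse of \<open>p\<^sub>v\<close> at \<open>|q|\<close>, so
  \<open>MA(v; \<cdot>)\<close> is the push-forward of Lebesgue measure under this map: a rotationally invariant
  measure giving the ball of radius \<open>r\<close> the mass \<open>\<kappa>\<^sub>n p\<^sub>v(r)\<^sup>n\<close>. A rotationally invariant
  Radon measure is determined by its values on centered balls. Expanding \<open>(\<Sum> \<lambda>\<^sub>i p\<^sub>i)\<^sup>n\<close>
  therefore identifies the mixed measure of radial \<open>v\<^sub>1, \<dots>, v\<^sub>n\<close> as the one with ball masses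
  \<open>\<kappa>\<^sub>n p\<^sub>1(r) \<cdots> p\<^sub>n(r)\<close>, and the equation becomes \<open>\<kappa>\<^sub>n p\<^sub>u(r)\<^sup>k = F\<^sub>\<mu>(r)\<close>, which
  can be solved exactly when \<open>F\<^sub>\<mu>\<close> is nondecreasing.\<close>

section \<open>Rotations and Lebesgue measure\<close>

text \<open>Fubini shows that translation invariant measures are proportional; \<open>lborel\<close> and its image
  under \<open>f\<close> agree on the unit ball \<open>B\<close>.\<close>
lemma lborel_distr_orthogonal:
  fixes f :: "'a::euclidean_space \<Rightarrow> 'a"
  assumes f: "orthogonal_transformation f"
  shows "distr lborel borel f = lborel"
proof -
  have lin: "linear f"
    using f by (rule orthogonal_transformation_linear)
  have [measurable]: "f \<in> borel_measurable borel"
    using lin by (intro borel_measurable_continuous_onI linear_continuous_on linear_conv_bounded_linear[THEN iffD1])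
  have fB: "f -` ball 0 1 = ball 0 1"
    using orthogonal_transformation_norm[OF f] by auto
  have shift: "(\<integral>\<^sup>+x. h (x + c) \<partial>lborel) = (\<integral>\<^sup>+x. h x \<partial>lborel)"
    if [measurable]: "h \<in> borel_measurable borel" for h :: "'a \<Rightarrow> ennreal" and c
  proof -
    have "(\<integral>\<^sup>+x. h x \<partial>lborel) = (\<integral>\<^sup>+x. h x \<partial>distr lborel borel ((+) c))"
      by (simp add: lborel_distr_plus)
    also have "\<dots> = (\<integral>\<^sup>+x. h (x + c) \<partial>lborel)"
      by (subst nn_integral_distr) (simp_all add: add.commute)
    finally show ?thesis by simp
  qed
  have refl: "(\<integral>\<^sup>+x. h (c - x) \<partial>lborel) = (\<integral>\<^sup>+x. h x \<partial>lborel)"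
    if [measurable]: "h \<in> borel_measurable borel" for h :: "'a \<Rightarrow> ennreal" and c
  proof -
    have "(\<integral>\<^sup>+x. h x \<partial>lborel) = (\<integral>\<^sup>+x. h x \<partial>density (distr lborel borel (\<lambda>x. c + (-1) *\<^sub>R x)) (\<lambda>_. 1))"
      by (subst lborel_affine[of "-1" c]) simp_all
    also have "\<dots> = (\<integral>\<^sup>+x. h (c - x) \<partial>lborel)"
      by (subst nn_integral_density, simp, simp, subst nn_integral_distr) simp_all
    finally show ?thesis by simp
  qed
  define B :: "'a set" where "B = ball 0 1"
  have [measurable]: "B \<in> sets borel" by (simp add: B_def)
  show ?thesis
  proof (rule measure_eqI)
    show "sets (distr lborel borel f) = sets lborel" by simp
    fix A assume "A \<in> sets (distr lborel borel f)"
    then have A[measurable]: "A \<in> sets borel" by simp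
    let ?I = "\<lambda>S x. indicator S x :: ennreal"
    \<comment> \<open>The double integral of the indicators of \<open>f x \<in> A\<close> and
      \<open>f x - y \<in> B\<close> is computed in two ways. Integrating over \<open>y\<close>
      first gives this product; shifting \<open>x\<close> by a preimage of \<open>y\<close> moves
      \<open>y\<close> into the condition for \<open>A\<close> and exchanges the roles of
      \<open>A\<close> and \<open>B\<close>.\<close>
    have "emeasure lborel (f -` A) * emeasure lborel B
        = (\<integral>\<^sup>+x. ?I A (f x) * (\<integral>\<^sup>+y. ?I B y \<partial>lborel) \<partial>lborel)"
      using measurable_sets_borel[of f borel A]
      by (simp add: nn_integral_multc indicator_vimage[symmetric] flip: nn_integral_indicator)
    also have "\<dots> = (\<integral>\<^sup>+x. (\<integral>\<^sup>+y. ?I A (f x) * ?I B (f x - y) \<partial>lborel) \<partial>lborel)"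
      by (simp add: refl nn_integral_cmult)
    also have "\<dots> = (\<integral>\<^sup>+y. (\<integral>\<^sup>+x. ?I A (f x) * ?I B (f x - y) \<partial>lborel) \<partial>lborel)"
      by (rule lborel_pair.Fubini') measurable
    also have "\<dots> = (\<integral>\<^sup>+y. (\<integral>\<^sup>+x. ?I A (f x + y) * ?I B (f x) \<partial>lborel) \<partial>lborel)"
    proof (rule nn_integral_cong)
      fix y
      obtain c where "f c = y"
        using orthogonal_transformation_surj[OF f] by (metis surjD)
      then show "(\<integral>\<^sup>+x. ?I A (f x) * ?I B (f x - y) \<partial>lborel) = (\<integral>\<^sup>+x. ?I A (f x + y) * ?I B (f x) \<partial>lborel)"
        by (subst shift[of _ c, symmetric]) (simp_all add: linear_add[OF lin])
    qed
    also have "\<dots> = (\<integral>\<^sup>+x. (\<integral>\<^sup>+y. ?I A (f x + y) * ?I B (f x) \<partial>lborel) \<partial>lborel)"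
      by (rule lborel_pair.Fubini') measurable
    also have "\<dots> = (\<integral>\<^sup>+x. (\<integral>\<^sup>+y. ?I A y \<partial>lborel) * ?I B (f x) \<partial>lborel)"
      by (simp add: nn_integral_multc add.commute[of "f _"] shift)
    also have "\<dots> = emeasure lborel A * emeasure lborel (f -` B)"
      using measurable_sets_borel[of f borel B]
      by (simp add: nn_integral_cmult indicator_vimage[symmetric] flip: nn_integral_indicator)
    also have "f -` B = B" using fB by (simp add: B_def)
    finally have "emeasure lborel B * emeasure lborel (f -` A) = emeasure lborel B * emeasure lborel A"
      by (simp add: mult.commute)
    moreover have "emeasure lborel B \<noteq> 0" "emeasure lborel B \<noteq> top"
      using emeasure_lborel_ball_finite[of 0 1] content_ball_pos[of 1 "0::'a"]
      by (auto simp: B_def measure_def)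
    ultimately show "emeasure (distr lborel borel f) A = emeasure lborel A"
      by (simp add: ennreal_mult_cancel_left emeasure_distr)
  qed
qed

text \<open>Transitivity of the rotation group on spheres is where dimension at least two enters: in
  dimension one the identity is the only rotation.\<close>

lemma rotation_between:
  fixes x y :: "real^'n"
  assumes "CARD('n) \<ge> 2" and "norm x = norm y"
  obtains Q where "rotation_matrix Q" "Q *v x = y"
proof -
  obtain f where f: "orthogonal_transformation f" "det (matrix f) = 1" "f x = y"
    using rotation_exists[OF assms(1), of x y] assms(2) by metis
  show thesis
    using that[of "matrix f"] f orthogonal_transformation_matrix[of f]
    by (auto simp: rotation_matrix_def matrix_works)
qed

lemma rotation_matrix_transpose: "rotation_matrix Q \<Longrightarrow> rotation_matrix (transpose Q)"
  for Q :: "real^'n^'n"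
  by (simp add: rotation_matrix_def orthogonal_matrix_transpose)

lemma rotation_matrix_cancel:
  fixes Q :: "real^'n^'n"
  assumes "rotation_matrix Q"
  shows "transpose Q *v (Q *v x) = x" "Q *v (transpose Q *v x) = x"
  using assms by (simp_all add: rotation_matrix_def orthogonal_matrix_def matrix_vector_mul_assoc
      del: transpose_matrix_vector)

lemma rotation_matrix_orthogonal_transformation:
  "rotation_matrix Q \<Longrightarrow> orthogonal_transformation ((*v) Q)" for Q :: "real^'n^'n"
  by (simp add: orthogonal_transformation_matrix rotation_matrix_def)

lemma norm_rotation_matrix: "rotation_matrix Q \<Longrightarrow> norm (Q *v x) = norm x" for Q :: "real^'n^'n"
  by (rule orthogonal_transformation_norm[OF rotation_matrix_orthogonal_transformation])

lemma rotation_matrix_image: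
  fixes Q :: "real^'n^'n"
  assumes "rotation_matrix Q"
  shows "(*v) Q ` A = (*v) (transpose Q) -` A"
proof (intro set_eqI iffI)
  show "x \<in> (*v) (transpose Q) -` A" if "x \<in> (*v) Q ` A" for x
    using that rotation_matrix_cancel[OF assms] by (auto simp del: transpose_matrix_vector)
  show "x \<in> (*v) Q ` A" if "x \<in> (*v) (transpose Q) -` A" for x
    using that by (intro image_eqI[where x = "transpose Q *v x"]) (auto simp: rotation_matrix_cancel[OF assms] simp del: transpose_matrix_vector)
qed

lemma measurable_matrix_vector_mult [measurable]: "(*v) Q \<in> borel_measurable borel"
  for Q :: "real^'n^'m"
  by (intro borel_measurable_continuous_onI linear_continuous_on matrix_vector_mul_bounded_linear)

lemma measurable_sgn_vec [measurable]: "(sgn :: real^'n \<Rightarrow> _) \<in> borel_measurable borel"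
  unfolding sgn_div_norm[abs_def] by measurable

text \<open>As a push-forward identity, invariance can be applied to integrals through
  \<open>nn_integral_distr\<close>. The two forms correspond because images under \<open>Q\<close>
  are preimages under its transpose.\<close>

lemma rotationally_invariant_iff_distr:
  fixes \<mu> :: "(real^'n) measure"
  assumes [measurable_cong, simp]: "sets \<mu> = sets borel"
  shows "rotationally_invariant \<mu> \<longleftrightarrow> (\<forall>Q. rotation_matrix Q \<longrightarrow> distr \<mu> borel ((*v) Q) = \<mu>)"
proof -
  have sp: "space \<mu> = UNIV" using sets_eq_imp_space_eq[OF assms] by simp
  have *: "emeasure (distr \<mu> borel ((*v) Q)) B = emeasure \<mu> ((*v) (transpose Q) ` B)"
    if "rotation_matrix Q" "B \<in> sets borel" for Q and B
    using that by (simp add: emeasure_distr sp rotation_matrix_image rotation_matrix_transpose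
        del: transpose_matrix_vector)
  show ?thesis
  proof (intro iffI allI impI)
    fix Q :: "real^'n^'n"
    assume "rotationally_invariant \<mu>" and Q: "rotation_matrix Q"
    then show "distr \<mu> borel ((*v) Q) = \<mu>"
      by (intro measure_eqI) (simp_all add: * rotationally_invariant_def rotation_matrix_transpose
          del: transpose_matrix_vector)
  next
    assume L: "\<forall>Q. rotation_matrix Q \<longrightarrow> distr \<mu> borel ((*v) Q) = \<mu>"
    show "rotationally_invariant \<mu>"
      unfolding rotationally_invariant_def
    proof (intro allI impI ballI)
      fix Q :: "real^'n^'n" and B :: "(real^'n) set"
      assume Q: "rotation_matrix Q" and B: "B \<in> sets borel"
      show "emeasure \<mu> ((*v) Q ` B) = emeasure \<mu> B"
        using *[OF rotation_matrix_transpose[OF Q] B] L rotation_matrix_transpose[OF Q] by simp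
    qed
  qed
qed

section \<open>Uniform density of exponential sums\<close>

inductive_set exp_sums :: "('a::euclidean_space \<Rightarrow> real) set" where
  scale: "(\<lambda>x. c * exp (y \<bullet> x)) \<in> exp_sums"
| add: "f \<in> exp_sums \<Longrightarrow> g \<in> exp_sums \<Longrightarrow> (\<lambda>x. f x + g x) \<in> exp_sums"

text \<open>Exponents add under multiplication, so the span of the exponentials is an algebra, as
  Stone-Weierstrass requires.\<close>

lemma exp_sums_mult:
  assumes "f \<in> exp_sums" "g \<in> exp_sums"
  shows "(\<lambda>x. f x * g x) \<in> exp_sums"
  using assms
proof (induction f rule: exp_sums.induct)
  case (scale c y)
  from scale.prems show ?case
  proof (induction g rule: exp_sums.induct)
    case (scale d z)
    have "(\<lambda>x. (c * d) * exp ((y + z) \<bullet> x)) \<in> exp_sums" by (rule exp_sums.scale)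
    then show ?case by (simp add: inner_add_left exp_add mult_ac)
  next
    case (add f g)
    then show ?case using exp_sums.add[of "\<lambda>x. c * exp (y \<bullet> x) * f x" "\<lambda>x. c * exp (y \<bullet> x) * g x"]
      by (simp add: distrib_left)
  qed
next
  case (add f1 f2)
  then show ?case using exp_sums.add[of "\<lambda>x. f1 x * g x" "\<lambda>x. f2 x * g x"]
    by (simp add: distrib_right)
qed

lemma exp_sums_continuous: "f \<in> exp_sums \<Longrightarrow> continuous_on S f"
  by (induction rule: exp_sums.induct) (auto intro!: continuous_intros)

text \<open>The exponential with exponent vector \<open>x - y\<close> separates \<open>x\<close>
  from \<open>y\<close>, so Stone-Weierstrass applies. Exponentials are chosen because their
  integrals against a rotationally invariant measure depend only on the length of the exponent
  vector.\<close>

lemma exp_sums_dense: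
  fixes f :: "'a::euclidean_space \<Rightarrow> real"
  assumes "compact S" "continuous_on S f" "e > 0"
  obtains g where "g \<in> exp_sums" "\<And>x. x \<in> S \<Longrightarrow> \<bar>f x - g x\<bar> < e"
proof -
  interpret function_ring_on exp_sums S
  proof
    show "(\<lambda>_. c) \<in> exp_sums" for c :: real
      using exp_sums.scale[of c 0] by simp
    fix x y :: 'a
    assume "x \<noteq> y"
    then have "(x - y) \<bullet> x \<noteq> (x - y) \<bullet> y"
      by (metis inner_diff_right inner_eq_zero_iff right_minus_eq)
    then show "\<exists>f\<in>exp_sums. f x \<noteq> f y"
      by (intro bexI[OF _ exp_sums.scale[of 1 "x - y"]]) simp
  qed (auto intro: assms exp_sums_continuous exp_sums.add exp_sums_mult)
  show thesis
    using Stone_Weierstrass_basic[OF assms(2,3)] that by blast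
qed

section \<open>Rotationally invariant measures are determined by balls\<close>

lemma emeasure_distr_norm_less:
  fixes \<mu> :: "(real^'n) measure"
  assumes "sets \<mu> = sets borel"
  shows "emeasure (distr \<mu> borel norm) {..<r} = emeasure \<mu> (ball 0 r)"
proof -
  note [measurable_cong] = assms
  have "space \<mu> = UNIV" using sets_eq_imp_space_eq[OF assms] by simp
  then have "norm -` {..<r} \<inter> space \<mu> = ball 0 r" by auto
  then show ?thesis by (simp add: emeasure_distr)
qed

lemma finite_measure_eqI_less_than:
  fixes M N :: "real measure"
  assumes "finite_measure M" and [simp]: "sets M = sets borel" "sets N = sets borel"
    and eq: "\<And>r. emeasure M {..<r} = emeasure N {..<r}"
  shows "M = N"
proof (rule measure_eqI_generator_eq[where E = "range lessThan" and \<Omega> = UNIV and A = "\<lambda>i. {..<real i}"])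
  have "{..<a} \<inter> {..<b} = {..<min a b}" for a b :: real by auto
  then show "Int_stable (range (lessThan :: real \<Rightarrow> _))"
    by (auto simp: Int_stable_def)
  show "sets M = sigma_sets UNIV (range lessThan)" "sets N = sigma_sets UNIV (range lessThan)"
    unfolding assms(2,3) borel_Iio by auto
  show "(\<Union>i. {..<real i}) = UNIV"
    using reals_Archimedean2 by auto
  show "emeasure M {..<real i} \<noteq> \<infinity>" for i
    using finite_measure.emeasure_finite[OF assms(1)] by simp
qed (use eq in auto)

text \<open>Closed sets form an intersection-stable generator of the Borel sets, and the indicator
  of a closed set is a pointwise limit of bounded continuous functions, so dominated convergence
  carries equality over to closed sets.\<close>

lemma finite_measure_eqI_continuous:
  fixes M N :: "'a::euclidean_space measure"
  assumes "finite_measure M" "finite_measure N"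
    and sets[simp]: "sets M = sets borel" "sets N = sets borel"
    and eq: "\<And>f :: 'a \<Rightarrow> real. continuous_on UNIV f \<Longrightarrow> range f \<subseteq> {0..1} \<Longrightarrow>
        integral\<^sup>L M f = integral\<^sup>L N f"
  shows "M = N"
proof -
  interpret M: finite_measure M by fact
  interpret N: finite_measure N by fact
  have closed_eq: "measure M C = measure N C" if C: "closed C" "C \<noteq> {}" for C
  proof -
    have [measurable]: "C \<in> sets borel" using C(1) by simp
    \<comment> \<open>For \<open>m > 0\<close>, \<open>f m\<close> is 1 on \<open>C\<close> and
      vanishes at distance at least \<open>1/m\<close> from \<open>C\<close>. The empty set is
      treated apart because \<open>infdist x {}\<close> is 0.\<close>
    define f where "f m x = max 0 (1 - real m * infdist x C)" for m x
    have cont: "continuous_on UNIV (f m)" for m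
      unfolding f_def by (intro continuous_intros continuous_on_infdist)
    have range: "range (f m) \<subseteq> {0..1}" for m
      by (auto simp: f_def infdist_nonneg)
    have lim: "(\<lambda>m. f m x) \<longlonglongrightarrow> indicator C x" for x
    proof (cases "x \<in> C")
      case True
      then show ?thesis by (simp add: f_def)
    next
      case False
      then have "infdist x C > 0"
        using C in_closed_iff_infdist_zero[OF C] infdist_nonneg[of x C] by fastforce
      then obtain m0 :: nat where "1 < real m0 * infdist x C"
        using reals_Archimedean3 by blast
      moreover have "real m0 * infdist x C \<le> real m * infdist x C" if "m \<ge> m0" for m
        using that \<open>infdist x C > 0\<close> by (intro mult_right_mono) simp_all
      ultimately have "eventually (\<lambda>m. f m x = 0) sequentially"
        by (intro eventually_sequentiallyI[of m0]) (fastforce simp: f_def)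
      then show ?thesis
        using False by (simp add: tendsto_eventually)
    qed
    have "(\<lambda>m. \<integral>x. f m x \<partial>L) \<longlonglongrightarrow> measure L C" if L: "finite_measure L" "sets L = sets borel" for L
    proof -
      interpret L: finite_measure L by fact
      note [measurable_cong] = L(2)
      have "(\<lambda>m. \<integral>x. f m x \<partial>L) \<longlonglongrightarrow> (\<integral>x. indicator C x \<partial>L)"
      proof (rule integral_dominated_convergence[where w = "\<lambda>_. 1"])
        show "f m \<in> borel_measurable L" for m
          using borel_measurable_continuous_onI[OF cont] by simp
        show "AE x in L. norm (f m x) \<le> 1" for m
          using range[of m] by (intro AE_I2) (auto simp: image_subset_iff)
        show "indicat_real C \<in> borel_measurable L"
          by measurable
      qed (auto intro: lim)
      moreover have "C \<in> sets L" using C by (simp add: L)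
      then have "(\<integral>x. indicator C x \<partial>L) = measure L C"
        using sets.sets_into_space by (auto simp: Int_absorb2)
      ultimately show ?thesis by simp
    qed
    from this[OF assms(1) sets(1)] this[OF assms(2) sets(2)] show ?thesis
      unfolding eq[OF cont range] by (rule LIMSEQ_unique)
  qed
  show ?thesis
  proof (rule measure_eqI_generator_eq[where E = "Collect closed" and \<Omega> = UNIV and A = "\<lambda>_. UNIV"])
    show "Int_stable (Collect closed :: 'a set set)"
      by (auto simp: Int_stable_def)
    show "sets M = sigma_sets UNIV (Collect closed)" "sets N = sigma_sets UNIV (Collect closed)"
      unfolding sets borel_eq_closed by auto
    show "emeasure M C = emeasure N C" if "C \<in> Collect closed" for C
      using that closed_eq[of C]
      by (cases "C = {}") (auto simp: M.emeasure_eq_measure N.emeasure_eq_measure)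
  qed auto
qed

text \<open>By rotation invariance the exponential moment may be averaged over all directions of
  \<open>y\<close>; by Fubini this turns the integrand into a function of \<open>norm x\<close> alone.\<close>
lemma nn_integral_exp_radial:
  fixes \<mu> \<nu> :: "(real^'n) measure"
  assumes n: "CARD('n) \<ge> 2"
    and fin: "finite_measure \<mu>" "finite_measure \<nu>"
    and sets: "sets \<mu> = sets borel" "sets \<nu> = sets borel"
    and rot: "rotationally_invariant \<mu>" "rotationally_invariant \<nu>"
    and balls: "\<And>r. r > 0 \<Longrightarrow> emeasure \<mu> (ball 0 r) = emeasure \<nu> (ball 0 r)"
  shows "(\<integral>\<^sup>+x. ennreal (exp (y \<bullet> x)) \<partial>\<mu>) = (\<integral>\<^sup>+x. ennreal (exp (y \<bullet> x)) \<partial>\<nu>)"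
proof -
  define B :: "(real^'n) set" where "B = ball 0 1"
  have B: "emeasure lborel B \<noteq> 0" "emeasure lborel B \<noteq> top"
    using emeasure_lborel_ball_finite[of 0 1] content_ball_pos[of 1 "0::real^'n"]
    by (auto simp: B_def measure_def)
  have [measurable]: "B \<in> sets borel" by (simp add: B_def)
  \<comment> \<open>Letting \<open>z\<close> range over the unit ball and keeping only
    \<open>sgn z\<close> stands in for the uniform measure on the sphere of radius
    \<open>norm y\<close>.\<close>
  define J where "J x = (\<integral>\<^sup>+z. ennreal (exp ((norm y *\<^sub>R sgn z) \<bullet> x)) * indicator B z \<partial>lborel)"
    for x :: "real^'n"
  have [measurable]: "J \<in> borel_measurable borel"
    unfolding J_def by measurable
  have J_rot: "J (Q *v x) = J x" if Q: "rotation_matrix Q" for Q x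
  proof -
    have lin: "linear ((*v) Q)" by (rule matrix_vector_mul_linear)
    have sgn: "sgn (Q *v z) = Q *v sgn z" for z
      by (simp add: sgn_div_norm norm_rotation_matrix[OF Q] linear_cmul[OF lin])
    have inner: "(Q *v a) \<bullet> (Q *v b) = a \<bullet> b" for a b
      using rotation_matrix_orthogonal_transformation[OF Q] by (simp add: orthogonal_transformation_def)
    have "J (Q *v x) = (\<integral>\<^sup>+z. ennreal (exp ((norm y *\<^sub>R sgn z) \<bullet> (Q *v x))) * indicator B z
        \<partial>distr lborel borel ((*v) Q))"
      by (simp add: J_def lborel_distr_orthogonal[OF rotation_matrix_orthogonal_transformation[OF Q]])
    also have "\<dots> = (\<integral>\<^sup>+z. ennreal (exp ((norm y *\<^sub>R sgn (Q *v z)) \<bullet> (Q *v x))) * indicator B (Q *v z) \<partial>lborel)"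
      by (subst nn_integral_distr) measurable
    also have "\<dots> = J x"
      unfolding J_def sgn
      by (simp add: inner B_def indicator_def norm_rotation_matrix[OF Q])
    finally show ?thesis .
  qed
  define e :: "real^'n" where "e = axis undefined 1"
  have e: "norm e = 1" by (simp add: e_def)
  have J_norm: "J x = J (norm x *\<^sub>R e)" for x
  proof -
    obtain Q where "rotation_matrix Q" "Q *v (norm x *\<^sub>R e) = x"
      by (rule rotation_between[OF n, of "norm x *\<^sub>R e" x]) (auto simp: e)
    then show ?thesis using J_rot by metis
  qed
  have avg: "(\<integral>\<^sup>+x. ennreal (exp (y \<bullet> x)) \<partial>L) * emeasure lborel B
      = (\<integral>\<^sup>+t. J (t *\<^sub>R e) \<partial>distr L borel norm)"
    if L: "finite_measure L" "sets L = sets borel" "rotationally_invariant L" for L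
  proof -
    note [measurable_cong] = L(2)
    interpret L: finite_measure L by fact
    interpret pair_sigma_finite L "lborel :: (real^'n) measure" ..
    have inv: "(\<integral>\<^sup>+x. ennreal (exp (z \<bullet> x)) \<partial>L) = (\<integral>\<^sup>+x. ennreal (exp (y \<bullet> x)) \<partial>L)"
      if zy: "norm z = norm y" for z
    proof -
      obtain Q where Q: "rotation_matrix Q" "Q *v y = z"
        by (rule rotation_between[OF n zy[symmetric]])
      have "(\<integral>\<^sup>+x. ennreal (exp (z \<bullet> x)) \<partial>L) = (\<integral>\<^sup>+x. ennreal (exp (z \<bullet> x)) \<partial>distr L borel ((*v) Q))"
        using L(3) Q(1) by (simp add: rotationally_invariant_iff_distr[OF L(2)])
      also have "\<dots> = (\<integral>\<^sup>+x. ennreal (exp (z \<bullet> (Q *v x))) \<partial>L)"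
        by (subst nn_integral_distr) measurable
      also have "\<dots> = (\<integral>\<^sup>+x. ennreal (exp (y \<bullet> x)) \<partial>L)"
        using rotation_matrix_orthogonal_transformation[OF Q(1)]
        by (simp add: orthogonal_transformation_def flip: Q(2))
      finally show ?thesis .
    qed
    have "(\<integral>\<^sup>+x. ennreal (exp (y \<bullet> x)) \<partial>L) * emeasure lborel B
        = (\<integral>\<^sup>+z. (\<integral>\<^sup>+x. ennreal (exp (y \<bullet> x)) \<partial>L) * indicator B z \<partial>lborel)"
      by (simp add: nn_integral_cmult)
    also have "\<dots> = (\<integral>\<^sup>+z. (\<integral>\<^sup>+x. ennreal (exp ((norm y *\<^sub>R sgn z) \<bullet> x)) \<partial>L) * indicator B z \<partial>lborel)"
    proof (rule nn_integral_cong_AE)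
      \<comment> \<open>At \<open>z = 0\<close> the vector \<open>norm y *\<^sub>R sgn z\<close>
        vanishes and need not have the length of \<open>y\<close>, so \<open>inv\<close> is used
        only off the origin.\<close>
      have "AE z in lborel. z \<noteq> (0::real^'n)" by (rule AE_lborel_singleton)
      then show "AE z in lborel. (\<integral>\<^sup>+x. ennreal (exp (y \<bullet> x)) \<partial>L) * indicator B z =
          (\<integral>\<^sup>+x. ennreal (exp ((norm y *\<^sub>R sgn z) \<bullet> x)) \<partial>L) * indicator B z"
        by eventually_elim (subst inv, auto simp: norm_sgn)
    qed
    also have "\<dots> = (\<integral>\<^sup>+z. (\<integral>\<^sup>+x. ennreal (exp ((norm y *\<^sub>R sgn z) \<bullet> x)) * indicator B z \<partial>L) \<partial>lborel)"
      by (simp add: nn_integral_multc)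
    also have "\<dots> = (\<integral>\<^sup>+x. J x \<partial>L)"
      unfolding J_def by (rule Fubini') measurable
    also have "\<dots> = (\<integral>\<^sup>+x. J (norm x *\<^sub>R e) \<partial>L)"
      by (intro nn_integral_cong J_norm)
    also have "\<dots> = (\<integral>\<^sup>+t. J (t *\<^sub>R e) \<partial>distr L borel norm)"
      by (subst nn_integral_distr) measurable
    finally show ?thesis .
  qed
  have "distr \<mu> borel norm = distr \<nu> borel norm"
  proof (rule finite_measure_eqI_less_than)
    have "(norm :: real^'n \<Rightarrow> real) \<in> borel_measurable borel" by measurable
    then have "norm \<in> borel_measurable \<mu>" by (simp cong: measurable_cong_sets[OF sets(1) refl])
    then show "finite_measure (distr \<mu> borel norm)"
      by (rule finite_measure.finite_measure_distr[OF fin(1)])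
    show "emeasure (distr \<mu> borel norm) {..<r} = emeasure (distr \<nu> borel norm) {..<r}" for r
      unfolding emeasure_distr_norm_less[OF sets(1)] emeasure_distr_norm_less[OF sets(2)]
      by (cases "r > 0") (simp_all add: balls ball_eq_empty[THEN iffD2])
  qed simp_all
  then have "(\<integral>\<^sup>+x. ennreal (exp (y \<bullet> x)) \<partial>\<mu>) * emeasure lborel B
      = (\<integral>\<^sup>+x. ennreal (exp (y \<bullet> x)) \<partial>\<nu>) * emeasure lborel B"
    using avg[OF fin(1) sets(1) rot(1)] avg[OF fin(2) sets(2) rot(2)] by simp
  then show ?thesis
    using B by (metis ennreal_mult_cancel_left mult.commute)
qed

text \<open>Exponential moments agree by \<open>nn_integral_exp_radial\<close>, and exponential sums
  are uniformly dense on \<open>cball 0 R\<close>. The bound \<open>R\<close> makes them integrable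
  and lets uniform approximation on a compact set control the integrals.\<close>

lemma finite_radial_measure_unique:
  fixes \<mu> \<nu> :: "(real^'n) measure"
  assumes n: "CARD('n) \<ge> 2"
    and fin: "finite_measure \<mu>" "finite_measure \<nu>"
    and sets: "sets \<mu> = sets borel" "sets \<nu> = sets borel"
    and rot: "rotationally_invariant \<mu>" "rotationally_invariant \<nu>"
    and balls: "\<And>r. r > 0 \<Longrightarrow> emeasure \<mu> (ball 0 r) = emeasure \<nu> (ball 0 r)"
    and bdd: "AE x in \<mu>. norm x \<le> R" "AE x in \<nu>. norm x \<le> R"
  shows "\<mu> = \<nu>"
proof (rule finite_measure_eqI_continuous[OF fin sets])
  fix f :: "real^'n \<Rightarrow> real"
  assume f: "continuous_on UNIV f" "range f \<subseteq> {0..1}"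
  have int: "integrable L g"
    if L: "finite_measure L" "sets L = sets borel" "AE x in L. norm x \<le> R" and g: "continuous_on UNIV g"
    for L and g :: "real^'n \<Rightarrow> real"
  proof -
    have "compact (g ` cball 0 R)"
      using g by (intro compact_continuous_image) (auto intro: continuous_on_subset)
    then have "bounded (g ` cball 0 R)" by (rule compact_imp_bounded)
    then obtain b where "\<forall>z\<in>g ` cball 0 R. norm z \<le> b"
      unfolding bounded_iff by (rule exE)
    then have b: "\<And>x. norm x \<le> R \<Longrightarrow> norm (g x) \<le> b" by simp
    show ?thesis
      using borel_measurable_continuous_onI[OF g]
      by (intro finite_measure.integrable_const_bound[OF L(1), of g b])
         (use eventually_mono[OF L(3) b] in \<open>auto cong: measurable_cong_sets[OF L(2) refl]\<close>)
  qed
  have exp: "(\<integral>x. g x \<partial>\<mu>) = (\<integral>x. g x \<partial>\<nu>)" if "g \<in> exp_sums" for g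
    using that
  proof induction
    case (scale c y)
    have "(\<integral>x. exp (y \<bullet> x) \<partial>L) = enn2real (\<integral>\<^sup>+x. ennreal (exp (y \<bullet> x)) \<partial>L)"
      if [measurable_cong]: "sets L = sets borel" for L :: "(real^'n) measure"
      by (rule integral_eq_nn_integral) auto
    then have "(\<integral>x. exp (y \<bullet> x) \<partial>\<mu>) = (\<integral>x. exp (y \<bullet> x) \<partial>\<nu>)"
      using nn_integral_exp_radial[OF n fin sets rot balls, of y] sets by simp
    then show ?case by simp
  next
    case (add f g)
    then show ?case
      using int[OF fin(1) sets(1) bdd(1)] int[OF fin(2) sets(2) bdd(2)]
      by (simp add: exp_sums_continuous)
  qed
  define m where "m = measure \<mu> (space \<mu>) + measure \<nu> (space \<nu>)"
  \<comment> \<open>Replacing \<open>f\<close> by an approximating \<open>g\<close> costs at most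
    \<open>e\<close> times the mass of each measure, and the integrals of \<open>g\<close>
    agree.\<close>
  have "\<bar>(\<integral>x. f x \<partial>\<mu>) - (\<integral>x. f x \<partial>\<nu>)\<bar> \<le> e * m" if e: "e > 0" for e
  proof -
    obtain g where g: "g \<in> exp_sums" and fg: "\<And>x. x \<in> cball 0 R \<Longrightarrow> \<bar>f x - g x\<bar> < e"
      using exp_sums_dense[OF compact_cball continuous_on_subset[OF f(1) subset_UNIV] e] by blast
    have *: "\<bar>(\<integral>x. f x \<partial>L) - (\<integral>x. g x \<partial>L)\<bar> \<le> e * measure L (space L)"
      if L: "finite_measure L" "sets L = sets borel" "AE x in L. norm x \<le> R" for L
    proof -
      interpret L: finite_measure L by fact
      note i = int[OF L f(1)] int[OF L exp_sums_continuous[OF g]]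
      have "\<bar>(\<integral>x. f x \<partial>L) - (\<integral>x. g x \<partial>L)\<bar> = norm (\<integral>x. f x - g x \<partial>L)"
        using i by simp
      also have "\<dots> \<le> (\<integral>x. norm (f x - g x) \<partial>L)" by (rule integral_norm_bound)
      also have "\<dots> \<le> (\<integral>x. e \<partial>L)"
        using i by (intro integral_mono_AE) (auto intro!: eventually_mono[OF L(3)] less_imp_le[OF fg])
      finally show ?thesis by (simp add: mult.commute)
    qed
    show ?thesis
      using *[OF fin(1) sets(1) bdd(1)] *[OF fin(2) sets(2) bdd(2)] exp[OF g]
      unfolding m_def distrib_left by linarith
  qed
  note le = this
  have "\<bar>(\<integral>x. f x \<partial>\<mu>) - (\<integral>x. f x \<partial>\<nu>)\<bar> \<le> 0"
  proof (rule field_le_epsilon)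
    fix e :: real assume e: "e > 0"
    have m: "m \<ge> 0" by (simp add: m_def)
    then have "e / (m + 1) * m \<le> e" using e by (simp add: field_simps)
    then show "\<bar>(\<integral>x. f x \<partial>\<mu>) - (\<integral>x. f x \<partial>\<nu>)\<bar> \<le> 0 + e"
      using le[of "e / (m + 1)"] e m by simp
  qed
  then show "(\<integral>x. f x \<partial>\<mu>) = (\<integral>x. f x \<partial>\<nu>)" by simp
qed

text \<open>Restriction to a centered ball preserves rotation invariance and yields finite measures
  of bounded support; centered balls then exhaust the space.\<close>

lemma radial_Radon_measure_unique:
  fixes \<mu> \<nu> :: "(real^'n) measure"
  assumes n: "CARD('n) \<ge> 2"
    and Radon: "Radon_measure \<mu>" "Radon_measure \<nu>"
    and rot: "rotationally_invariant \<mu>" "rotationally_invariant \<nu>"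
    and balls: "\<And>r. r > 0 \<Longrightarrow> emeasure \<mu> (ball 0 r) = emeasure \<nu> (ball 0 r)"
  shows "\<mu> = \<nu>"
proof (rule measure_eqI)
  have sets: "sets \<mu> = sets borel" "sets \<nu> = sets borel"
    using Radon by (auto simp: Radon_measure_def)
  then show "sets \<mu> = sets \<nu>" by simp
  fix A assume "A \<in> sets \<mu>"
  then have A: "A \<in> sets borel" by (simp add: sets)
  have part: "emeasure \<mu> (A \<inter> ball 0 R) = emeasure \<nu> (A \<inter> ball 0 R)" if R: "R > 0" for R
  proof -
    define cut where "cut L = density L (indicator (ball (0::real^'n) R))" for L
    have cut: "sets (cut L) = sets borel" "finite_measure (cut L)" "rotationally_invariant (cut L)"
        "AE x in cut L. norm x \<le> R" "\<And>S. S \<in> sets borel \<Longrightarrow> emeasure (cut L) S = emeasure L (S \<inter> ball 0 R)"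
      if L: "Radon_measure L" "rotationally_invariant L" for L
    proof -
      have sL [measurable_cong, simp]: "sets L = sets borel" using L by (auto simp: Radon_measure_def)
      have sp: "space L = UNIV" using sets_eq_imp_space_eq[OF sL] by simp
      show s: "sets (cut L) = sets borel" by (simp add: cut_def)
      show em: "emeasure (cut L) S = emeasure L (S \<inter> ball 0 R)" if "S \<in> sets borel" for S
        unfolding cut_def using that
        by (simp add: emeasure_restricted Int_commute)
      have "emeasure L (ball 0 R) \<le> emeasure L (cball 0 R)"
        by (intro emeasure_mono) auto
      also have "\<dots> < \<infinity>" using L by (auto simp: Radon_measure_def)
      finally show "finite_measure (cut L)"
        using em[of UNIV] by (intro finite_measureI) (auto simp: cut_def sp)
      show "AE x in cut L. norm x \<le> R"
        unfolding cut_def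
        by (subst AE_density) (auto split: split_indicator intro!: borel_measurable_indicator)
      show "rotationally_invariant (cut L)"
        unfolding rotationally_invariant_def
      proof (intro allI impI ballI)
        fix Q :: "real^'n^'n" and S :: "(real^'n) set"
        assume Q: "rotation_matrix Q" and S: "S \<in> sets borel"
        have QS: "(*v) Q ` S \<in> sets borel"
          using measurable_sets_borel[OF measurable_matrix_vector_mult S]
          by (simp add: rotation_matrix_image[OF Q] del: transpose_matrix_vector)
        have "(*v) Q ` S \<inter> ball 0 R = (*v) Q ` (S \<inter> ball 0 R)"
          by (auto simp: norm_rotation_matrix[OF Q])
        then show "emeasure (cut L) ((*v) Q ` S) = emeasure (cut L) S"
          using L(2) Q S by (simp add: em QS rotationally_invariant_def)
      qed
    qed
    note c1 = cut[OF Radon(1) rot(1)] and c2 = cut[OF Radon(2) rot(2)]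
    have "cut \<mu> = cut \<nu>"
    proof (rule finite_radial_measure_unique[OF n c1(2) c2(2) c1(1) c2(1) c1(3) c2(3) _ c1(4) c2(4)])
      fix r :: real assume "r > 0"
      then have "ball 0 r \<inter> ball 0 R = ball (0::real^'n) (min r R)" "min r R > 0" using R by auto
      then show "emeasure (cut \<mu>) (ball 0 r) = emeasure (cut \<nu>) (ball 0 r)"
        by (simp add: c1 c2 balls)
    qed
    then show ?thesis using c1(5)[OF A] c2(5)[OF A] by simp
  qed
  \<comment> \<open>\<open>Suc\<close> keeps the radius positive, as \<open>part\<close>
    requires.\<close>
  have sup: "emeasure L A = (SUP i::nat. emeasure L (A \<inter> ball 0 (real (Suc i))))" if "sets L = sets borel" for L
  proof -
    have "(SUP i::nat. emeasure L (A \<inter> ball 0 (real (Suc i)))) = emeasure L (\<Union>i. A \<inter> ball 0 (real (Suc i)))"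
      by (rule SUP_emeasure_incseq) (auto simp: that A incseq_def)
    also have "(\<Union>i. A \<inter> ball 0 (real (Suc i))) = A"
    proof (intro equalityI subsetI)
      fix x assume "x \<in> A"
      obtain i where "norm x < real i" using reals_Archimedean2 by blast
      then have "norm x < real (Suc i)" by simp
      with \<open>x \<in> A\<close> show "x \<in> (\<Union>i. A \<inter> ball 0 (real (Suc i)))" by auto
    qed auto
    finally show ?thesis by simp
  qed
  show "emeasure \<mu> A = emeasure \<nu> A"
    unfolding sup[OF sets(1)] sup[OF sets(2)] by (intro SUP_cong part refl) simp
qed

section \<open>Radial push-forwards of Lebesgue measure\<close>

text \<open>These are the properties of \<open>p_v\<close> that matter. Left continuity is the
  counterpart of using open balls, and only positive radii are constrained, so the value at 0 stays
  free.\<close>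

definition profile :: "(real \<Rightarrow> real) \<Rightarrow> bool" where
  "profile G \<longleftrightarrow> mono_on {0<..} G \<and> (\<forall>r>0. 0 \<le> G r \<and> (G \<longlongrightarrow> G r) (at_left r))"

lemma profile_mono: "profile G \<Longrightarrow> 0 < r \<Longrightarrow> r \<le> s \<Longrightarrow> G r \<le> G s"
  by (auto simp: profile_def mono_on_def)

lemma profile_nonneg: "profile G \<Longrightarrow> 0 < r \<Longrightarrow> 0 \<le> G r"
  by (auto simp: profile_def)

lemma profile_left_approx:
  assumes "profile G" "0 < r" "s < G r"
  obtains r' where "0 < r'" "r' < r" "s < G r'"
proof -
  have "(G \<longlongrightarrow> G r) (at_left r)"
    using assms by (auto simp: profile_def)
  from order_tendstoD(1)[OF this assms(3)] have "eventually (\<lambda>x. s < G x) (at_left r)" .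
  moreover have "eventually (\<lambda>x. x \<in> {0<..<r}) (at_left r)"
    using assms(2) by (rule eventually_at_left_real)
  ultimately have "eventually (\<lambda>x. s < G x \<and> x \<in> {0<..<r}) (at_left r)"
    by (rule eventually_conj)
  then obtain x where "s < G x \<and> x \<in> {0<..<r}"
    using eventually_happens' trivial_limit_at_left_real by blast
  then show thesis using that by auto
qed

text \<open>For a monotone function, left continuity amounts to every value below \<open>G r\<close>
  being exceeded at a smaller radius, which is easy to check for suprema and for masses of open
  balls.\<close>

lemma profileI:
  assumes mono: "\<And>r s. 0 < r \<Longrightarrow> r \<le> s \<Longrightarrow> G r \<le> G s"
    and nonneg: "\<And>r. 0 < r \<Longrightarrow> 0 \<le> G r"
    and approx: "\<And>r s. 0 < r \<Longrightarrow> s < G r \<Longrightarrow> \<exists>r'>0. r' < r \<and> s < G r'"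
  shows "profile G"
  unfolding profile_def
proof (intro conjI allI impI)
  show "mono_on {0<..} G" using mono by (auto simp: mono_on_def)
  fix r :: real assume r: "0 < r"
  show "0 \<le> G r" using nonneg r .
  show "(G \<longlongrightarrow> G r) (at_left r)"
  proof (rule order_tendstoI)
    fix s assume "s < G r"
    then obtain r' where r': "0 < r'" "r' < r" "s < G r'" using approx r by blast
    have "eventually (\<lambda>x. x \<in> {r'<..<r}) (at_left r)"
      using r'(2) by (rule eventually_at_left_real)
    then show "eventually (\<lambda>x. s < G x) (at_left r)"
      by eventually_elim (meson r' mono greaterThanLessThan_iff less_imp_le less_le_trans)
  next
    fix s assume s: "G r < s"
    have "eventually (\<lambda>x. x \<in> {0<..<r}) (at_left r)"
      using r by (rule eventually_at_left_real)
    then show "eventually (\<lambda>x. G x < s) (at_left r)"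
      by eventually_elim (meson s mono greaterThanLessThan_iff less_imp_le le_less_trans)
  qed
qed

section \<open>Generalized inverses of profiles and the induced radial push-forward\<close>

definition gen_inverse :: "(real \<Rightarrow> real) \<Rightarrow> real \<Rightarrow> real" where
  "gen_inverse G s = Inf {r. 0 < r \<and> s < G r}"

text \<open>Exactly for these \<open>s\<close> does the infimum in \<open>gen_inverse\<close> run
  over a nonempty set.\<close>

definition below_sup :: "(real \<Rightarrow> real) \<Rightarrow> real set" where
  "below_sup G = {s. \<exists>r>0. s < G r}"

text \<open>Both inequalities can be strict thanks to left continuity: \<open>s < G r\<close>
  persists at a slightly smaller radius, so the infimum stays strictly below
  \<open>r\<close>.\<close>

lemma gen_inverse_less_iff:
  assumes G: "profile G" and s: "s \<in> below_sup G" and r: "0 < r"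
  shows "gen_inverse G s < r \<longleftrightarrow> s < G r"
proof -
  let ?S = "{r. 0 < r \<and> s < G r}"
  have "?S \<noteq> {}" using s by (auto simp: below_sup_def)
  then have "gen_inverse G s < r \<longleftrightarrow> (\<exists>x\<in>?S. x < r)"
    unfolding gen_inverse_def by (intro cInf_less_iff) (auto intro: bdd_belowI[of _ 0])
  also have "\<dots> \<longleftrightarrow> s < G r"
  proof
    assume "\<exists>x\<in>?S. x < r"
    then show "s < G r" using profile_mono[OF G, of _ r] by (auto intro: less_le_trans)
  next
    assume "s < G r"
    then show "\<exists>x\<in>?S. x < r" using profile_left_approx[OF G r] by blast
  qed
  finally show ?thesis .
qed

lemma gen_inverse_nonneg: "s \<in> below_sup G \<Longrightarrow> 0 \<le> gen_inverse G s"
  unfolding gen_inverse_def below_sup_def by (intro cInf_greatest) auto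

lemma measurable_below_sup: "below_sup G \<in> sets borel"
proof -
  have "below_sup G = (\<Union>r\<in>{0<..}. {..<G r})" by (auto simp: below_sup_def)
  then have "open (below_sup G)" by (metis open_UN open_lessThan)
  then show ?thesis by simp
qed

definition gen_inverse0 :: "(real \<Rightarrow> real) \<Rightarrow> real \<Rightarrow> real" where
  "gen_inverse0 G s = (if s \<in> below_sup G then gen_inverse G s else 0)"

text \<open>The inverse of the subdifferential of the radial convex function with profile \<open>G\<close>; the
  value \<open>0\<close> of \<open>gen_inverse0\<close> outside \<open>below_sup G\<close> is irrelevant, as \<open>radial_measure\<close>
  ignores these points.\<close>
definition radial_map :: "(real \<Rightarrow> real) \<Rightarrow> real^'n \<Rightarrow> real^'n" where
  "radial_map G p = gen_inverse0 G (norm p) *\<^sub>R sgn p"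

text \<open>The density discards vectors at least as long as the supremum of \<open>G\<close>.
  Without it, a bounded profile would send infinite mass to the origin through the default value of
  \<open>gen_inverse0\<close>.\<close>

definition radial_measure :: "(real \<Rightarrow> real) \<Rightarrow> (real^'n) measure" where
  "radial_measure G = distr (density lborel (indicator {p. norm p \<in> below_sup G})) borel (radial_map G)"

lemma measurable_gen_inverse0:
  assumes G: "profile G"
  shows "gen_inverse0 G \<in> borel_measurable borel"
proof (rule borel_measurableI_less)
  fix r
  show "{s \<in> space borel. gen_inverse0 G s < r} \<in> sets borel"
  proof (cases "0 < r")
    case True
    \<comment> \<open>Outside \<open>below_sup G\<close> the default value 0 lies below the positive
      \<open>r\<close>, which accounts for the complement.\<close>
    then have "{s \<in> space borel. gen_inverse0 G s < r} = {..<G r} \<union> - below_sup G"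
      using gen_inverse_less_iff[OF G _ True] by (auto simp: gen_inverse0_def below_sup_def)
    then show ?thesis using measurable_below_sup[of G] by auto
  next
    case False
    then have "{s \<in> space borel. gen_inverse0 G s < r} = {}"
      using gen_inverse_nonneg by (force simp: gen_inverse0_def)
    then show ?thesis by simp
  qed
qed

lemma measurable_radial_map: "profile G \<Longrightarrow> radial_map G \<in> borel_measurable borel"
  using measurable_gen_inverse0 unfolding radial_map_def[abs_def] by measurable

lemma measurable_norm_below_sup: "{p :: real^'n. norm p \<in> below_sup G} \<in> sets borel"
proof -
  have "(norm :: real^'n \<Rightarrow> real) \<in> borel_measurable borel" by measurable
  from measurable_sets_borel[OF this measurable_below_sup[of G]] show ?thesis
    by (simp add: vimage_def)
qed

lemma sets_radial_measure [simp]: "sets (radial_measure G) = sets borel"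
  by (simp add: radial_measure_def)

lemma emeasure_radial_measure:
  fixes B :: "(real^'n) set"
  assumes G: "profile G" and B: "B \<in> sets borel"
  shows "emeasure (radial_measure G) B
    = emeasure lborel {p :: real^'n. norm p \<in> below_sup G \<and> radial_map G p \<in> B}"
proof -
  have *: "radial_map G -` B \<in> sets borel"
    using measurable_sets_borel[OF measurable_radial_map[OF G] B] .
  have "emeasure (radial_measure G) B
    = emeasure (density lborel (indicator {p. norm p \<in> below_sup G})) (radial_map G -` B)"
    unfolding radial_measure_def
  proof (subst emeasure_distr[OF _ B])
    show "radial_map G \<in> borel_measurable (density lborel (indicator {p :: real^'n. norm p \<in> below_sup G}))"
      using measurable_radial_map[OF G] by (simp cong: measurable_cong_sets)
  qed simp
  also have "\<dots> = emeasure lborel ({p. norm p \<in> below_sup G} \<inter> radial_map G -` B)"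
    using * measurable_norm_below_sup by (intro emeasure_restricted) auto
  finally show ?thesis by (simp add: Collect_conj_eq vimage_def)
qed

lemma radial_map_rotation:
  assumes Q: "rotation_matrix Q"
  shows "radial_map G (Q *v p) = Q *v radial_map G p"
  using linear_cmul[OF matrix_vector_mul_linear, of Q]
  by (simp add: radial_map_def sgn_div_norm norm_rotation_matrix[OF Q])

text \<open>The radial map commutes with rotations, and Lebesgue measure is invariant under
  them.\<close>

lemma rotationally_invariant_radial_measure:
  assumes G: "profile G"
  shows "rotationally_invariant (radial_measure G :: (real^'n) measure)"
  unfolding rotationally_invariant_def
proof (intro allI impI ballI)
  fix Q :: "real^'n^'n" and B :: "(real^'n) set"
  assume Q: "rotation_matrix Q" and B: "B \<in> sets borel"
  let ?S = "\<lambda>B. {p. norm p \<in> below_sup G \<and> radial_map G p \<in> B}"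
  have QB: "(*v) Q ` B \<in> sets borel"
    using measurable_sets_borel[OF measurable_matrix_vector_mult B]
    by (simp add: rotation_matrix_image[OF Q] del: transpose_matrix_vector)
  have eq: "(*v) Q -` ?S ((*v) Q ` B) = ?S B"
  proof -
    have "inj ((*v) Q)" by (metis injI rotation_matrix_cancel(1)[OF Q])
    then show ?thesis
      by (auto simp: radial_map_rotation[OF Q] norm_rotation_matrix[OF Q] inj_image_mem_iff)
  qed
  have "?S ((*v) Q ` B) = {p. norm p \<in> below_sup G} \<inter> radial_map G -` ((*v) Q ` B)" by auto
  also have "\<dots> \<in> sets borel"
    using measurable_norm_below_sup measurable_sets_borel[OF measurable_radial_map[OF G] QB] by auto
  finally have meas: "?S ((*v) Q ` B) \<in> sets borel" .
  have "emeasure lborel (?S ((*v) Q ` B)) = emeasure (distr lborel borel ((*v) Q)) (?S ((*v) Q ` B))"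
    by (simp add: lborel_distr_orthogonal[OF rotation_matrix_orthogonal_transformation[OF Q]])
  also have "\<dots> = emeasure lborel (?S B)"
    using eq meas by (subst emeasure_distr) simp_all
  finally show "emeasure (radial_measure G) ((*v) Q ` B) = emeasure (radial_measure G) B"
    by (simp add: emeasure_radial_measure[OF G] B QB)
qed

text \<open>By \<open>gen_inverse_less_iff\<close>, the preimage of the ball of radius
  \<open>r\<close> is the ball of radius \<open>G r\<close>, up to the origin.\<close>

lemma emeasure_radial_measure_ball:
  assumes G: "profile G" and r: "0 < r"
  shows "emeasure (radial_measure G) (ball (0::real^'n) r)
    = ennreal (measure lborel (ball (0::real^'n) 1) * G r ^ CARD('n))"
proof -
  have in_iff: "norm p \<in> below_sup G \<and> radial_map G p \<in> ball 0 r \<longleftrightarrow> p \<in> ball 0 (G r)"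
    if "p \<noteq> 0" for p :: "real^'n"
  proof (cases "norm p \<in> below_sup G")
    case True
    then show ?thesis
      using gen_inverse_less_iff[OF G True r] gen_inverse_nonneg[OF True] that
      by (simp add: radial_map_def norm_sgn gen_inverse0_def)
  next
    case False
    then show ?thesis using r by (auto simp: below_sup_def)
  qed
  have "emeasure (radial_measure G) (ball (0::real^'n) r)
      = emeasure lborel {p :: real^'n. norm p \<in> below_sup G \<and> radial_map G p \<in> ball 0 r}"
    by (intro emeasure_radial_measure G) auto
  also have "\<dots> = emeasure lborel (ball (0::real^'n) (G r))"
  proof (rule emeasure_eq_AE)
    \<comment> \<open>The origin is always mapped to itself, hence into the ball, whereas
      \<open>ball 0 (G r)\<close> is empty when \<open>G r = 0\<close>.\<close>
    have "AE p in lborel. p \<noteq> (0::real^'n)" by (rule AE_lborel_singleton)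
    then show "AE p in lborel. p \<in> {p :: real^'n. norm p \<in> below_sup G \<and> radial_map G p \<in> ball 0 r}
        \<longleftrightarrow> p \<in> ball 0 (G r)"
      by eventually_elim (use in_iff in blast)
    have "{p :: real^'n. norm p \<in> below_sup G \<and> radial_map G p \<in> ball 0 r}
        = {p. norm p \<in> below_sup G} \<inter> radial_map G -` ball 0 r" by auto
    also have "\<dots> \<in> sets borel"
      using measurable_norm_below_sup measurable_sets_borel[OF measurable_radial_map[OF G], of "ball 0 r"] by auto
    finally show "{p :: real^'n. norm p \<in> below_sup G \<and> radial_map G p \<in> ball 0 r} \<in> sets lborel" by simp
  qed simp
  also have "\<dots> = ennreal (measure lborel (ball (0::real^'n) 1) * G r ^ CARD('n))"
    using profile_nonneg[OF G r] emeasure_ball[of "G r" "0::real^'n"] content_ball[of 1 "0::real^'n"]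
    by simp
  finally show ?thesis .
qed

lemma Radon_measure_if_balls_finite:
  fixes \<mu> :: "(real^'n) measure"
  assumes sets: "sets \<mu> = sets borel" and fin: "\<And>r. 0 < r \<Longrightarrow> emeasure \<mu> (ball 0 r) < \<infinity>"
  shows "Radon_measure \<mu>"
  unfolding Radon_measure_def
proof (intro conjI allI impI sets)
  fix K :: "(real^'n) set" assume "compact K"
  then obtain r where r: "0 < r" "K \<subseteq> ball 0 r"
    using compact_imp_bounded bounded_subset_ballD by blast
  then have "emeasure \<mu> K \<le> emeasure \<mu> (ball 0 r)"
    by (intro emeasure_mono) (auto simp: sets)
  also have "\<dots> < \<infinity>" by (rule fin[OF r(1)])
  finally show "emeasure \<mu> K < \<infinity>" .
qed

lemma Radon_measure_radial_measure: "profile G \<Longrightarrow> Radon_measure (radial_measure G :: (real^'n) measure)"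
  by (rule Radon_measure_if_balls_finite) (simp_all add: emeasure_radial_measure_ball)

section \<open>Radially symmetric convex functions\<close>

text \<open>A real-valued version of \<open>p_v\<close>, faithful for radial convex \<open>v\<close>
  by \<open>psup_finite\<close>. At radius 0 it is 0, since the supremum runs over the empty
  set.\<close>

definition rprofile :: "(real^'n \<Rightarrow> real) \<Rightarrow> real \<Rightarrow> real" where
  "rprofile v r = enn2real (psup v r)"

lemma subdifferentialD: "p \<in> subdifferential u x \<Longrightarrow> u x + p \<bullet> (z - x) \<le> u z"
  by (simp add: subdifferential_def)

lemma radially_symmetricD: "radially_symmetric u \<Longrightarrow> norm x = norm y \<Longrightarrow> u x = u y"
  unfolding radially_symmetric_def by blast

lemma inner_sgn_self: "x \<bullet> sgn x = norm x" for x :: "'a::real_inner"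
  by (cases "x = 0") (simp_all add: sgn_div_norm dot_square_norm power2_eq_square)

text \<open>Turning \<open>z\<close> into the direction of \<open>p\<close> leaves
  \<open>v z\<close> unchanged and makes the inner product as large as possible.\<close>

lemma radial_subgradient_ineq:
  fixes v :: "real^'n \<Rightarrow> real"
  assumes rad: "radially_symmetric v" and p: "p \<in> subdifferential v x"
  shows "v x + norm p * (norm z - norm x) \<le> v z"
proof (cases "p = 0")
  case True
  then show ?thesis using subdifferentialD[OF p, of z] by simp
next
  case False
  let ?z = "norm z *\<^sub>R sgn p"
  have "v z = v ?z"
    using False by (intro radially_symmetricD[OF rad]) (simp add: norm_sgn)
  moreover have "p \<bullet> (?z - x) \<ge> norm p * (norm z - norm x)"
    using norm_cauchy_schwarz[of p x] by (simp add: inner_diff_right inner_sgn_self algebra_simps)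
  ultimately show ?thesis using subdifferentialD[OF p, of ?z] by linarith
qed

text \<open>A converse to \<open>radial_subgradient_ineq\<close>: Cauchy-Schwarz holds with equality
  at \<open>x\<close> and bounds the inner product at every other point.\<close>

lemma radial_subgradientI:
  fixes v :: "real^'n \<Rightarrow> real"
  assumes "p \<bullet> x = norm p * norm x" and "\<And>z. v x + norm p * (norm z - norm x) \<le> v z"
  shows "p \<in> subdifferential v x"
  unfolding subdifferential_def
proof (intro CollectI allI)
  fix z
  have "p \<bullet> (z - x) \<le> norm p * (norm z - norm x)"
    using norm_cauchy_schwarz[of p z] assms(1) by (simp add: inner_diff_right algebra_simps)
  then show "v x + p \<bullet> (z - x) \<le> v z" using assms(2)[of z] by linarith
qed

lemma radial_convex_min:
  fixes v :: "real^'n \<Rightarrow> real"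
  assumes "v \<in> Conv" "radially_symmetric v"
  shows "v 0 \<le> v x"
proof -
  have "v ((1 - 1/2) *\<^sub>R x + (1/2) *\<^sub>R (- x)) \<le> (1 - 1/2) * v x + (1/2) * v (- x)"
    using assms(1) by (intro convex_onD[where A = UNIV]) (auto simp: Conv_def)
  moreover have "v (- x) = v x" by (rule radially_symmetricD[OF assms(2)]) simp
  ultimately show ?thesis by simp
qed

text \<open>Adding the two radial subgradient inequalities shows that slopes grow with the
  radius.\<close>

lemma subgradient_norm_mono:
  fixes v :: "real^'n \<Rightarrow> real"
  assumes rad: "radially_symmetric v" and "p \<in> subdifferential v x" "q \<in> subdifferential v y"
    and "norm x < norm y"
  shows "norm p \<le> norm q"
proof -
  have "(norm q - norm p) * (norm y - norm x) \<ge> 0"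
    using radial_subgradient_ineq[OF rad assms(2), of y] radial_subgradient_ineq[OF rad assms(3), of x]
    by (simp add: algebra_simps)
  then show ?thesis using assms(4) by (simp add: zero_le_mult_iff)
qed

lemma radial_subgradient_exists:
  fixes v :: "real^'n \<Rightarrow> real"
  assumes conv: "v \<in> Conv" and rad: "radially_symmetric v"
  obtains p where "p \<in> subdifferential v x"
proof (cases "x = 0")
  case True
  then have "0 \<in> subdifferential v x"
    using radial_convex_min[OF assms] by (simp add: subdifferential_def)
  then show thesis by (rule that)
next
  case False
  define e :: "real^'n" where "e = sgn x"
  have e: "norm e = 1" using False by (simp add: e_def norm_sgn)
  define f where "f t = v (t *\<^sub>R e)" for t
  have f: "v z = f (norm z)" for z
    unfolding f_def by (intro radially_symmetricD[OF rad]) (simp add: e)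
  have "convex_on UNIV f"
  proof (rule convex_onI)
    fix t a b :: real assume "0 < t" "t < 1"
    then have "v ((1 - t) *\<^sub>R (a *\<^sub>R e) + t *\<^sub>R (b *\<^sub>R e)) \<le> (1 - t) * v (a *\<^sub>R e) + t * v (b *\<^sub>R e)"
      using conv by (intro convex_onD[where A = UNIV]) (auto simp: Conv_def)
    then show "f ((1 - t) *\<^sub>R a + t *\<^sub>R b) \<le> (1 - t) * f a + t * f b"
      by (simp add: f_def algebra_simps)
  qed simp
  then obtain s where s: "\<And>t. f (norm x) + s * (t - norm x) \<le> f t"
    using convex_le_Inf_differential[of UNIV f "norm x"] by auto
  \<comment> \<open>Evenness of \<open>f\<close> forces the slope to be nonnegative, so it is the
    length of the vector \<open>s *\<^sub>R e\<close>.\<close>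
  have "f (- norm x) = f (norm x)"
    unfolding f_def by (intro radially_symmetricD[OF rad]) simp
  then have "s * norm x \<ge> 0" using s[of "- norm x"] by simp
  then have "s \<ge> 0" using False by (simp add: zero_le_mult_iff)
  have "s *\<^sub>R e \<in> subdifferential v x"
  proof (rule radial_subgradientI)
    show "(s *\<^sub>R e) \<bullet> x = norm (s *\<^sub>R e) * norm x"
      using \<open>s \<ge> 0\<close> e inner_sgn_self[of x] by (simp add: e_def inner_commute)
    show "v x + norm (s *\<^sub>R e) * (norm z - norm x) \<le> v z" for z
      using s[of "norm z"] \<open>s \<ge> 0\<close> by (simp add: f e)
  qed
  then show thesis by (rule that)
qed

lemma psup_finite:
  fixes v :: "real^'n \<Rightarrow> real"
  assumes conv: "v \<in> Conv" and rad: "radially_symmetric v"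
  shows "psup v r < \<infinity>"
proof (cases "r > 0")
  case True
  \<comment> \<open>A radius exceeding \<open>r\<close> by 1 makes \<open>norm z - norm x\<close> at
    least 1 for all points \<open>x\<close> in the ball, which bounds every slope by one increment
    of \<open>v\<close>.\<close>
  define z :: "real^'n" where "z = (r + 1) *\<^sub>R axis undefined 1"
  have z: "norm z = r + 1" using True by (simp add: z_def)
  have "norm p \<le> v z - v 0" if "norm x < r" "p \<in> subdifferential v x" for p x
  proof -
    have "norm p * 1 \<le> norm p * (norm z - norm x)"
      using that(1) by (intro mult_left_mono) (auto simp: z)
    then show ?thesis
      using radial_subgradient_ineq[OF rad that(2), of z] radial_convex_min[OF conv rad, of x] by simp
  qed
  then have "psup v r \<le> ennreal (v z - v 0)"
    unfolding psup_def by (intro Sup_least) (auto intro: ennreal_leI)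
  then show ?thesis by (simp add: le_less_trans[OF _ ennreal_less_top])
next
  case False
  then have "\<not> norm x < r" for x :: "real^'n" using norm_ge_zero[of x] by linarith
  then have "{ennreal (norm p) |p x. norm x < r \<and> p \<in> subdifferential v x} = {}" by blast
  then have "psup v r = Sup {}" unfolding psup_def by (rule arg_cong)
  then show ?thesis by (simp add: bot_ennreal)
qed

lemma psup_eq_rprofile:
  fixes v :: "real^'n \<Rightarrow> real"
  assumes "v \<in> Conv" "radially_symmetric v"
  shows "psup v r = ennreal (rprofile v r)"
  using psup_finite[OF assms, of r] by (simp add: rprofile_def)

lemma rprofile_nonneg: "0 \<le> rprofile v r"
  by (simp add: rprofile_def)

lemma rprofile_zero [simp]: "rprofile v 0 = 0"
proof -
  have "{ennreal (norm p) |p x. norm x < 0 \<and> p \<in> subdifferential v x} = {}" by auto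
  then show ?thesis unfolding rprofile_def psup_def by (simp add: bot_ennreal)
qed

lemma rprofile_upper:
  fixes v :: "real^'n \<Rightarrow> real"
  assumes "v \<in> Conv" "radially_symmetric v" and "norm x < r" "p \<in> subdifferential v x"
  shows "norm p \<le> rprofile v r"
proof -
  have "ennreal (norm p) \<le> psup v r"
    unfolding psup_def using assms(3,4) by (intro Sup_upper) auto
  then show ?thesis by (simp add: psup_eq_rprofile[OF assms(1,2)] rprofile_nonneg)
qed

lemma rprofile_least:
  fixes v :: "real^'n \<Rightarrow> real"
  assumes "0 \<le> c" and "\<And>x p. norm x < r \<Longrightarrow> p \<in> subdifferential v x \<Longrightarrow> norm p \<le> c"
  shows "rprofile v r \<le> c"
proof -
  have "psup v r \<le> ennreal c"
    unfolding psup_def by (intro Sup_least) (auto intro!: ennreal_leI assms(2))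
  then have "enn2real (psup v r) \<le> enn2real (ennreal c)" by (intro enn2real_mono) simp_all
  then show ?thesis using assms(1) by (simp add: rprofile_def)
qed

lemma rprofile_less_exists:
  fixes v :: "real^'n \<Rightarrow> real"
  assumes "0 \<le> c" and "c < rprofile v r"
  obtains x p where "norm x < r" "p \<in> subdifferential v x" "c < norm p"
  using rprofile_least[OF assms(1), of r v] assms(2) by force

lemma rprofile_mono:
  fixes v :: "real^'n \<Rightarrow> real"
  assumes "v \<in> Conv" "radially_symmetric v" "r \<le> s"
  shows "rprofile v r \<le> rprofile v s"
proof (rule rprofile_least[OF rprofile_nonneg])
  fix x p assume "norm x < r" and p: "p \<in> subdifferential v x"
  then show "norm p \<le> rprofile v s" using assms(3) by (intro rprofile_upper[OF assms(1,2) _ p]) simp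
qed

text \<open>Left continuity comes from the strict bound \<open>norm x < r\<close> in
  \<open>psup\<close>: a subgradient that counts for \<open>r\<close> counts already for a radius
  between \<open>norm x\<close> and \<open>r\<close>.\<close>

lemma profile_rprofile:
  fixes v :: "real^'n \<Rightarrow> real"
  assumes v: "v \<in> Conv" "radially_symmetric v"
  shows "profile (rprofile v)"
proof (rule profileI)
  fix r s :: real assume r: "0 < r" and s: "s < rprofile v r"
  show "\<exists>r'>0. r' < r \<and> s < rprofile v r'"
  proof (cases "0 \<le> s")
    case True
    then obtain x p where "norm x < r" "p \<in> subdifferential v x" "s < norm p"
      using rprofile_less_exists s by metis
    then have "s < rprofile v ((norm x + r) / 2)"
      using rprofile_upper[OF v, of x "(norm x + r) / 2" p] by simp
    then show ?thesis
      using r \<open>norm x < r\<close> by (intro exI[of _ "(norm x + r) / 2"]) (auto simp: add_nonneg_pos)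
  next
    case False
    then show ?thesis using r rprofile_nonneg[of v "r / 2"] by (intro exI[of _ "r / 2"]) auto
  qed
qed (auto intro: rprofile_mono[OF v] rprofile_nonneg)

text \<open>The lower bound uses a subgradient at radius \<open>a\<close>, which is at least as long
  as all those further in. The upper bound uses subgradients at radii approaching \<open>b\<close>
  from below.\<close>

lemma rprofile_increment_bounds:
  fixes v :: "real^'n \<Rightarrow> real"
  assumes v: "v \<in> Conv" "radially_symmetric v"
    and e: "norm e = 1" and ab: "0 \<le> a" "a \<le> b"
  shows "rprofile v a * (b - a) \<le> v (b *\<^sub>R e) - v (a *\<^sub>R e)"
    and "v (b *\<^sub>R e) - v (a *\<^sub>R e) \<le> rprofile v b * (b - a)"
proof -
  obtain q where q: "q \<in> subdifferential v (a *\<^sub>R e)"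
    by (rule radial_subgradient_exists[OF v])
  have "rprofile v a \<le> norm q"
    by (rule rprofile_least) (use subgradient_norm_mono[OF v(2) _ q] ab e in auto)
  then have "rprofile v a * (b - a) \<le> norm q * (b - a)"
    using ab by (intro mult_right_mono) auto
  then show "rprofile v a * (b - a) \<le> v (b *\<^sub>R e) - v (a *\<^sub>R e)"
    using radial_subgradient_ineq[OF v(2) q, of "b *\<^sub>R e"] ab e by simp
  show "v (b *\<^sub>R e) - v (a *\<^sub>R e) \<le> rprofile v b * (b - a)"
  proof (cases "a = b")
    case False
    then have "a < b" using ab by simp
    have cont: "continuous_on UNIV v"
      using v(1) by (intro convex_on_continuous) (auto simp: Conv_def)
    \<comment> \<open>Subgradients at radius \<open>b\<close> itself do not count for
      \<open>rprofile v b\<close> and may be longer, so the estimate is made at \<open>c < b\<close>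
      and passed to the limit by continuity of \<open>v\<close>.\<close>
    have "((\<lambda>c. c *\<^sub>R e) \<longlongrightarrow> b *\<^sub>R e) (at_left b)" by (intro tendsto_intros)
    from continuous_on_tendsto_compose[OF cont this]
    have left: "((\<lambda>c. v (c *\<^sub>R e) - v (a *\<^sub>R e)) \<longlongrightarrow> v (b *\<^sub>R e) - v (a *\<^sub>R e)) (at_left b)"
      by (intro tendsto_intros) simp_all
    have right: "((\<lambda>c. rprofile v b * (c - a)) \<longlongrightarrow> rprofile v b * (b - a)) (at_left b)"
      by (auto intro!: tendsto_intros)
    have "eventually (\<lambda>c. c \<in> {a<..<b}) (at_left b)"
      using \<open>a < b\<close> by (rule eventually_at_left_real)
    then have "eventually (\<lambda>c. v (c *\<^sub>R e) - v (a *\<^sub>R e) \<le> rprofile v b * (c - a)) (at_left b)"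
    proof eventually_elim
      case (elim c)
      obtain q where q: "q \<in> subdifferential v (c *\<^sub>R e)"
        by (rule radial_subgradient_exists[OF v])
      have "norm q \<le> rprofile v b"
        using elim ab e by (intro rprofile_upper[OF v _ q]) auto
      then have "norm q * (c - a) \<le> rprofile v b * (c - a)"
        using elim by (intro mult_right_mono) auto
      then show ?case
        using radial_subgradient_ineq[OF v(2) q, of "a *\<^sub>R e"] ab e elim by (simp add: algebra_simps)
    qed
    then show ?thesis
      by (rule tendsto_le[OF trivial_limit_at_left_real right left])
  qed simp
qed

text \<open>\<open>rprofile v r\<close> is the left derivative at \<open>r\<close> of the radial part of \<open>v\<close>; unlike the
  supremum, this description is visibly linear in \<open>v\<close>.\<close>
lemma rprofile_left_derivative:
  fixes v :: "real^'n \<Rightarrow> real"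
  assumes v: "v \<in> Conv" "radially_symmetric v" and e: "norm e = 1" and r: "0 < r"
  shows "((\<lambda>a. (v (r *\<^sub>R e) - v (a *\<^sub>R e)) / (r - a)) \<longlongrightarrow> rprofile v r) (at_left r)"
proof (rule tendsto_sandwich)
  have ev: "eventually (\<lambda>a. a \<in> {0<..<r}) (at_left r)"
    using r by (rule eventually_at_left_real)
  show "eventually (\<lambda>a. rprofile v a \<le> (v (r *\<^sub>R e) - v (a *\<^sub>R e)) / (r - a)) (at_left r)"
    using ev by eventually_elim (use rprofile_increment_bounds(1)[OF v e] in \<open>simp add: le_divide_eq\<close>)
  show "eventually (\<lambda>a. (v (r *\<^sub>R e) - v (a *\<^sub>R e)) / (r - a) \<le> rprofile v r) (at_left r)"
    using ev by eventually_elim (use rprofile_increment_bounds(2)[OF v e] in \<open>simp add: divide_le_eq\<close>)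
  show "(rprofile v \<longlongrightarrow> rprofile v r) (at_left r)"
    using profile_rprofile[OF v] r by (simp add: profile_def)
qed simp

section \<open>Linearity of the profile\<close>

lemma Conv_add: "u \<in> Conv \<Longrightarrow> v \<in> Conv \<Longrightarrow> (\<lambda>x. u x + v x) \<in> Conv"
  by (simp add: Conv_def convex_on_add)

lemma Conv_scale: "v \<in> Conv \<Longrightarrow> 0 \<le> c \<Longrightarrow> (\<lambda>x. c * v x) \<in> Conv"
  by (simp add: Conv_def convex_on_cmul)

lemma radially_symmetric_add:
  "radially_symmetric u \<Longrightarrow> radially_symmetric v \<Longrightarrow> radially_symmetric (\<lambda>x. u x + v x)"
  unfolding radially_symmetric_def by metis

lemma radially_symmetric_scale: "radially_symmetric v \<Longrightarrow> radially_symmetric (\<lambda>x. c * v x)"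
  unfolding radially_symmetric_def by metis

lemma rprofile_add:
  fixes u v :: "real^'n \<Rightarrow> real"
  assumes u: "u \<in> Conv" "radially_symmetric u" and v: "v \<in> Conv" "radially_symmetric v" and r: "0 < r"
  shows "rprofile (\<lambda>x. u x + v x) r = rprofile u r + rprofile v r"
proof -
  define e :: "real^'n" where "e = axis undefined 1"
  have e: "norm e = 1" by (simp add: e_def)
  have "((\<lambda>a. (u (r *\<^sub>R e) - u (a *\<^sub>R e)) / (r - a) + (v (r *\<^sub>R e) - v (a *\<^sub>R e)) / (r - a))
      \<longlongrightarrow> rprofile u r + rprofile v r) (at_left r)"
    by (intro tendsto_add rprofile_left_derivative u v e r)
  then have "((\<lambda>a. ((u (r *\<^sub>R e) + v (r *\<^sub>R e)) - (u (a *\<^sub>R e) + v (a *\<^sub>R e))) / (r - a))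
      \<longlongrightarrow> rprofile u r + rprofile v r) (at_left r)"
    by (simp add: add_divide_distrib diff_divide_distrib algebra_simps)
  from tendsto_unique[OF trivial_limit_at_left_real
      rprofile_left_derivative[OF Conv_add[OF u(1) v(1)] radially_symmetric_add[OF u(2) v(2)] e r] this]
  show ?thesis .
qed

lemma rprofile_scale:
  fixes v :: "real^'n \<Rightarrow> real"
  assumes v: "v \<in> Conv" "radially_symmetric v" and c: "0 \<le> c" and r: "0 < r"
  shows "rprofile (\<lambda>x. c * v x) r = c * rprofile v r"
proof -
  define e :: "real^'n" where "e = axis undefined 1"
  have e: "norm e = 1" by (simp add: e_def)
  have "((\<lambda>a. c * ((v (r *\<^sub>R e) - v (a *\<^sub>R e)) / (r - a))) \<longlongrightarrow> c * rprofile v r) (at_left r)"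
    by (intro tendsto_mult_left rprofile_left_derivative v e r)
  then have "((\<lambda>a. (c * v (r *\<^sub>R e) - c * v (a *\<^sub>R e)) / (r - a)) \<longlongrightarrow> c * rprofile v r) (at_left r)"
    by (simp add: right_diff_distrib)
  from tendsto_unique[OF trivial_limit_at_left_real
      rprofile_left_derivative[OF Conv_scale[OF v(1) c] radially_symmetric_scale[OF v(2)] e r] this]
  show ?thesis .
qed

text \<open>Convexity and symmetry of the partial sums are carried along because the induction step
  needs them for \<open>rprofile_add\<close>.\<close>

lemma rprofile_sum:
  fixes w :: "'i \<Rightarrow> real^'n \<Rightarrow> real"
  assumes "finite I" and "\<And>i. i \<in> I \<Longrightarrow> w i \<in> Conv \<and> radially_symmetric (w i) \<and> 0 \<le> l i"
  shows "(\<lambda>x. \<Sum>i\<in>I. l i * w i x) \<in> Conv \<and> radially_symmetric (\<lambda>x. \<Sum>i\<in>I. l i * w i x) \<and>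
    (\<forall>r>0. rprofile (\<lambda>x. \<Sum>i\<in>I. l i * w i x) r = (\<Sum>i\<in>I. l i * rprofile (w i) r))"
  using assms
proof (induction I)
  case empty
  define z :: "real^'n \<Rightarrow> real" where "z = (\<lambda>_. 0)"
  have z: "z \<in> Conv" "radially_symmetric z"
    by (auto simp: z_def Conv_def radially_symmetric_def convex_on_const)
  have "rprofile z r = 0" if "0 < r" for r
    using rprofile_scale[OF z, of 0 r] that by (simp add: z_def)
  then show ?case using z by (simp add: z_def)
next
  case (insert i I)
  let ?s = "\<lambda>x. \<Sum>i\<in>I. l i * w i x"
  have s: "?s \<in> Conv" "radially_symmetric ?s"
    and sr: "\<And>r. 0 < r \<Longrightarrow> rprofile ?s r = (\<Sum>i\<in>I. l i * rprofile (w i) r)"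
    using insert by auto
  have w: "w i \<in> Conv" "radially_symmetric (w i)" "0 \<le> l i"
    using insert.prems[of i] by auto
  note lw = Conv_scale[OF w(1,3)] radially_symmetric_scale[OF w(2), of "l i"]
  have "(\<lambda>x. \<Sum>i\<in>insert i I. l i * w i x) = (\<lambda>x. l i * w i x + ?s x)"
    using insert.hyps by simp
  moreover have "rprofile (\<lambda>x. l i * w i x + ?s x) r = (\<Sum>i\<in>insert i I. l i * rprofile (w i) r)"
    if "0 < r" for r
    using insert.hyps rprofile_add[OF lw s that] sr[OF that] rprofile_scale[OF w that] by simp
  ultimately show ?case
    using Conv_add[OF lw(1) s(1)] radially_symmetric_add[OF lw(2) s(2)] by simp
qed

section \<open>Monge-Ampere measures of radial functions\<close>

text \<open>If the profile has no flat piece at height \<open>norm p\<close>, then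
  \<open>norm p < rprofile v \<rho>\<close> holds exactly for \<open>\<rho> > norm x\<close>. This
  characterizes \<open>norm x\<close> as the generalized inverse; equality in Cauchy-Schwarz fixes
  the direction of \<open>x\<close>.\<close>

lemma radial_subgradient_unique_point:
  fixes v :: "real^'n \<Rightarrow> real"
  assumes v: "v \<in> Conv" "radially_symmetric v" and p: "p \<in> subdifferential v x" "p \<noteq> 0"
    and level: "\<not> (\<exists>a b. 0 < a \<and> a < b \<and> rprofile v a = norm p \<and> rprofile v b = norm p)"
  shows "norm p \<in> below_sup (rprofile v)" and "radial_map (rprofile v) p = x"
proof -
  let ?G = "rprofile v"
  have G: "profile ?G" by (rule profile_rprofile[OF v])
  have less_iff: "norm p < ?G \<rho> \<longleftrightarrow> norm x < \<rho>" if \<rho>: "0 < \<rho>" for \<rho>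
  proof
    assume "norm x < \<rho>"
    \<comment> \<open>If \<open>rprofile v \<rho>\<close> were equal to \<open>norm p\<close>, the
      profile would take this value at both \<open>c\<close> and \<open>\<rho>\<close>, contrary to
      \<open>level\<close>.\<close>
    define c where "c = (norm x + \<rho>) / 2"
    have c: "0 < c" "norm x < c" "c < \<rho>"
      using \<open>norm x < \<rho>\<close> norm_ge_zero[of x] \<rho> by (auto simp: c_def add_nonneg_pos)
    have "norm p \<le> ?G c" using rprofile_upper[OF v c(2) p(1)] .
    moreover have "?G c \<le> ?G \<rho>" using rprofile_mono[OF v] c by simp
    moreover have "\<not> (?G c = norm p \<and> ?G \<rho> = norm p)" using level c by blast
    ultimately show "norm p < ?G \<rho>" by linarith
  next
    assume less: "norm p < ?G \<rho>"
    show "norm x < \<rho>"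
    proof (rule ccontr)
      assume "\<not> norm x < \<rho>"
      then have "?G \<rho> \<le> norm p"
        by (intro rprofile_least) (auto intro: subgradient_norm_mono[OF v(2) _ p(1)])
      with less show False by simp
    qed
  qed
  have "norm p < ?G (norm x + 1)"
    using less_iff[of "norm x + 1"] norm_ge_zero[of x] by (simp add: add_nonneg_pos)
  then show below: "norm p \<in> below_sup ?G"
    unfolding below_sup_def by (intro CollectI exI[of _ "norm x + 1"]) (simp add: add_nonneg_pos)
  have "gen_inverse ?G (norm p) = norm x"
  proof (rule ccontr)
    let ?g = "gen_inverse ?G (norm p)"
    have nonneg: "0 \<le> ?g" by (rule gen_inverse_nonneg[OF below])
    assume "?g \<noteq> norm x"
    then consider "?g < norm x" | "norm x < ?g" by linarith
    then obtain \<rho> where "0 < \<rho>" "(?g < \<rho>) \<noteq> (norm x < \<rho>)"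
    proof cases
      case 1
      then have "0 < norm x" using nonneg by linarith
      with 1 show thesis using that[of "norm x"] by simp
    next
      case 2
      then have "0 < ?g" using norm_ge_zero[of x] by linarith
      with 2 show thesis using that[of ?g] by simp
    qed
    then show False
      using gen_inverse_less_iff[OF G below, of \<rho>] less_iff[of \<rho>] by simp
  qed
  moreover have "norm x *\<^sub>R sgn p = x"
  proof -
    \<comment> \<open>Testing the subgradient inequality at \<open>x\<close> rotated into the
      direction of \<open>p\<close> gives the reverse Cauchy-Schwarz inequality.\<close>
    have "v (norm x *\<^sub>R sgn p) = v x"
      using p(2) by (intro radially_symmetricD[OF v(2)]) (simp add: norm_sgn)
    then have "norm p * norm x \<le> p \<bullet> x"
      using subdifferentialD[OF p(1), of "norm x *\<^sub>R sgn p"]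
      by (simp add: inner_diff_right inner_sgn_self mult.commute)
    then have "p \<bullet> x = norm p * norm x"
      using norm_cauchy_schwarz[of p x] by simp
    then have "norm p *\<^sub>R x = norm x *\<^sub>R p"
      by (simp add: norm_cauchy_schwarz_eq)
    then have "inverse (norm p) *\<^sub>R (norm p *\<^sub>R x) = inverse (norm p) *\<^sub>R (norm x *\<^sub>R p)" by simp
    then show ?thesis using p(2) by (simp add: sgn_div_norm mult.commute)
  qed
  ultimately show "radial_map ?G p = x"
    using below by (simp add: radial_map_def gen_inverse0_def)
qed

text \<open>A subgradient longer than \<open>p\<close> makes \<open>v\<close> minus the linear form
  of \<open>p\<close> coercive; any minimizer then has \<open>p\<close> as a subgradient.\<close>

lemma subgradient_surj_below_sup:
  fixes v :: "real^'n \<Rightarrow> real"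
  assumes v: "v \<in> Conv" "radially_symmetric v" and p: "norm p \<in> below_sup (rprofile v)"
  obtains x where "p \<in> subdifferential v x"
proof -
  obtain r where "norm p < rprofile v r"
    using p by (auto simp: below_sup_def)
  then obtain y q where q: "q \<in> subdifferential v y" "norm p < norm q"
    using rprofile_less_exists norm_ge_zero by metis
  define h where "h z = v z - p \<bullet> z" for z
  \<comment> \<open>The quotient is the radius beyond which the lower bound for \<open>h\<close>
    obtained from \<open>q\<close> exceeds \<open>h 0\<close>; the maximum with 0 keeps the origin
    in the ball.\<close>
  define R where "R = max 0 ((h 0 - v y + norm q * norm y) / (norm q - norm p))"
  have cont: "continuous_on UNIV v"
    using v(1) by (intro convex_on_continuous) (auto simp: Conv_def)
  have "continuous_on (cball 0 R) h"
    unfolding h_def by (intro continuous_intros continuous_on_subset[OF cont]) auto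
  then obtain x where x: "x \<in> cball 0 R" "\<And>z. z \<in> cball 0 R \<Longrightarrow> h x \<le> h z"
    using continuous_attains_inf[of "cball 0 R" h] by (auto simp: R_def)
  have "h x \<le> h z" for z
  proof (cases "z \<in> cball 0 R")
    case False
    then have "(h 0 - v y + norm q * norm y) / (norm q - norm p) \<le> norm z"
      by (simp add: R_def)
    then have "h 0 - v y + norm q * norm y \<le> norm z * (norm q - norm p)"
      using q(2) by (simp add: divide_le_eq)
    moreover have "v y + norm q * (norm z - norm y) \<le> v z"
      by (rule radial_subgradient_ineq[OF v(2) q(1)])
    moreover have "p \<bullet> z \<le> norm p * norm z" by (rule norm_cauchy_schwarz)
    ultimately have "h 0 \<le> h z"
      by (simp add: h_def algebra_simps)
    moreover have "h x \<le> h 0" by (rule x(2)) (simp add: R_def)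
    ultimately show ?thesis by simp
  qed (rule x(2))
  then have "p \<in> subdifferential v x"
    by (simp add: subdifferential_def h_def inner_diff_right algebra_simps)
  then show thesis by (rule that)
qed

text \<open>Off a null set, a vector is a subgradient at some point of \<open>B\<close> exactly when
  it lies in the preimage of \<open>B\<close> that defines \<open>radial_measure\<close>.\<close>

lemma MA_radial:
  fixes v :: "real^'n \<Rightarrow> real"
  assumes v: "v \<in> Conv" "radially_symmetric v" and B: "B \<in> sets borel"
  shows "MA v B = emeasure (radial_measure (rprofile v)) B"
proof -
  let ?G = "rprofile v"
  define U where "U = (\<Union>x\<in>B. subdifferential v x)"
  define V where "V = {p. norm p \<in> below_sup ?G \<and> radial_map ?G p \<in> B}"
  have G: "profile ?G" by (rule profile_rprofile[OF v])
  \<comment> \<open>On an interval where the profile is constant it takes its value at a rational point, so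
    only countably many spheres carry gradients attained at more than one point.\<close>
  define N :: "(real^'n) set" where "N = insert 0 (\<Union>s\<in>?G ` \<rat>. sphere 0 s)"
  have "negligible (\<Union>s\<in>?G ` \<rat>. sphere (0::real^'n) s)"
    by (rule negligible_countable_Union) (auto intro: countable_rat negligible_sphere)
  then have N: "N \<in> null_sets lebesgue"
    by (simp add: N_def negligible_iff_null_sets[symmetric])
  have level: "\<not> (\<exists>a b. 0 < a \<and> a < b \<and> ?G a = norm p \<and> ?G b = norm p)" if "p \<notin> N" for p
  proof
    assume "\<exists>a b. 0 < a \<and> a < b \<and> ?G a = norm p \<and> ?G b = norm p"
    then obtain a b where ab: "a < b" "?G a = norm p" "?G b = norm p" by blast
    obtain c where c: "c \<in> \<rat>" "a < c" "c < b" using Rats_dense_in_real[OF ab(1)] by blast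
    then have "?G c = norm p"
      using rprofile_mono[OF v, of a c] rprofile_mono[OF v, of c b] ab by simp
    then have "p \<in> sphere 0 (?G c)" by simp
    then have "p \<in> N" unfolding N_def using imageI[OF c(1), of ?G] by blast
    with that show False ..
  qed
  have UV: "p \<in> U \<longleftrightarrow> p \<in> V" if p: "p \<notin> N" for p
  proof -
    have p0: "p \<noteq> 0" using p by (auto simp: N_def)
    show ?thesis
    proof
      assume "p \<in> U"
      then show "p \<in> V"
        using radial_subgradient_unique_point[OF v _ p0 level[OF p]] by (auto simp: U_def V_def)
    next
      assume V: "p \<in> V"
      then obtain x where x: "p \<in> subdifferential v x"
        using subgradient_surj_below_sup[OF v] unfolding V_def by blast
      then show "p \<in> U"
        using radial_subgradient_unique_point(2)[OF v x p0 level[OF p]] V by (auto simp: U_def V_def)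
    qed
  qed
  have "V = {p. norm p \<in> below_sup ?G} \<inter> radial_map ?G -` B" by (auto simp: V_def)
  also have "\<dots> \<in> sets borel"
    using measurable_norm_below_sup measurable_sets_borel[OF measurable_radial_map[OF G] B] by (rule sets.Int)
  finally have V: "V \<in> sets borel" .
  \<comment> \<open>\<open>U\<close> need not be Borel. It is Lebesgue measurable because it differs
    from the Borel set \<open>V\<close> only inside \<open>N\<close> and Lebesgue measure is
    complete.\<close>
  have "U \<inter> N \<in> null_sets lebesgue"
    using N by (rule null_sets_completion_subset[rotated]) simp
  moreover have "V - N \<in> sets lebesgue"
    using V N by (intro sets.Diff) auto
  moreover have "U = (V - N) \<union> (U \<inter> N)" using UV by blast
  ultimately have U: "U \<in> sets lebesgue"
    by (metis null_setsD2 sets.Un)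
  have "MA v B = emeasure lebesgue U" by (simp add: MA_def U_def)
  also have "\<dots> = emeasure lebesgue V"
    using AE_not_in[OF N] U V by (intro emeasure_eq_AE) (auto elim!: eventually_mono simp: UV)
  also have "\<dots> = emeasure (radial_measure ?G) B"
    using V by (simp add: emeasure_radial_measure[OF G B] V_def)
  finally show ?thesis .
qed

section \<open>Mixed Monge-Ampere measures of radial functions\<close>

definition radial_Conv :: "(real^'n \<Rightarrow> real) set" where
  "radial_Conv = {v \<in> Conv. radially_symmetric v}"

lemma profile_mult: "profile G \<Longrightarrow> profile H \<Longrightarrow> profile (\<lambda>r. G r * H r)"
  unfolding profile_def mono_on_def by (auto intro!: mult_mono tendsto_mult)

lemma profile_prod_list: "(\<And>G. G \<in> set Gs \<Longrightarrow> profile G) \<Longrightarrow> profile (\<lambda>r. \<Prod>G\<leftarrow>Gs. G r)"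
proof (induction Gs)
  case Nil
  then show ?case by (simp add: profile_def mono_on_def)
next
  case (Cons G Gs)
  then show ?case using profile_mult[of G "\<lambda>r. \<Prod>G\<leftarrow>Gs. G r"] by simp
qed

lemma profile_root: "profile G \<Longrightarrow> 0 < n \<Longrightarrow> profile (\<lambda>r. root n (G r))"
  unfolding profile_def mono_on_def by (auto intro!: tendsto_real_root)

lemma profile_prod_rprofile:
  fixes us :: "(real^'n \<Rightarrow> real) list"
  assumes "set us \<subseteq> radial_Conv"
  shows "profile (\<lambda>r. \<Prod>v\<leftarrow>us. rprofile v r)"
  using profile_prod_list[of "map rprofile us"] assms
  by (auto simp: comp_def radial_Conv_def intro: profile_rprofile)

text \<open>The root produces a profile whose power with exponent \<open>CARD('n)\<close> is the
  product of the entries' profiles, so balls receive the mass expected of the mixed measure.\<close>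

definition radial_mixed_MA :: "(real^'n \<Rightarrow> real) list \<Rightarrow> (real^'n) measure" where
  "radial_mixed_MA us = radial_measure (\<lambda>r. root CARD('n) (\<Prod>v\<leftarrow>us. rprofile v r))"

lemma
  fixes us :: "(real^'n \<Rightarrow> real) list"
  assumes us: "set us \<subseteq> radial_Conv"
  shows Radon_radial_mixed_MA: "Radon_measure (radial_mixed_MA us)"
    and rotationally_invariant_radial_mixed_MA: "rotationally_invariant (radial_mixed_MA us)"
    and emeasure_radial_mixed_MA_ball: "0 < r \<Longrightarrow> emeasure (radial_mixed_MA us) (ball 0 r)
      = ennreal (measure lborel (ball (0::real^'n) 1) * (\<Prod>v\<leftarrow>us. rprofile v r))"
proof -
  have P: "profile (\<lambda>r. \<Prod>v\<leftarrow>us. rprofile v r)" by (rule profile_prod_rprofile[OF us])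
  then have G: "profile (\<lambda>r. root CARD('n) (\<Prod>v\<leftarrow>us. rprofile v r))"
    by (rule profile_root) simp
  show "Radon_measure (radial_mixed_MA us)" "rotationally_invariant (radial_mixed_MA us)"
    unfolding radial_mixed_MA_def
    by (rule Radon_measure_radial_measure[OF G] rotationally_invariant_radial_measure[OF G])+
  assume r: "0 < r"
  show "emeasure (radial_mixed_MA us) (ball 0 r)
      = ennreal (measure lborel (ball (0::real^'n) 1) * (\<Prod>v\<leftarrow>us. rprofile v r))"
    unfolding radial_mixed_MA_def emeasure_radial_measure_ball[OF G r]
    using profile_nonneg[OF P r] by (simp add: real_root_pow_pos2)
qed

text \<open>The multinomial expansion is indexed by ordered lists to match the sum in
  \<open>mixed_MA_on\<close>.\<close>

lemma power_sum_eq_sum_lists: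
  fixes f :: "'i \<Rightarrow> 'a::comm_semiring_1"
  assumes A: "finite A"
  shows "(\<Sum>i\<in>A. f i) ^ n = (\<Sum>is | set is \<subseteq> A \<and> length is = n. \<Prod>i\<leftarrow>is. f i)"
proof (induction n)
  case 0
  have "{is. set is \<subseteq> A \<and> length is = 0} = {[]}" by auto
  then show ?case by simp
next
  case (Suc n)
  let ?S = "\<lambda>n. {is. set is \<subseteq> A \<and> length is = n}"
  have eq: "?S (Suc n) = (\<lambda>(i, is). i # is) ` (A \<times> ?S n)"
    by (auto simp: length_Suc_conv image_iff)
  have "(\<Sum>is\<in>?S (Suc n). \<Prod>i\<leftarrow>is. f i) = (\<Sum>(i, is)\<in>A \<times> ?S n. f i * (\<Prod>i\<leftarrow>is. f i))"
    unfolding eq by (subst sum.reindex) (auto simp: inj_on_def intro!: sum.cong)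
  also have "\<dots> = (\<Sum>i\<in>A. f i) * (\<Sum>is\<in>?S n. \<Prod>i\<leftarrow>is. f i)"
    by (simp add: sum_product sum.cartesian_product)
  finally show ?case by (simp add: Suc.IH)
qed

text \<open>Uniqueness on balls compares two measures, so the right-hand side of the polynomial
  identity has to be available as a measure.\<close>

lemma finite_sum_measure_exists:
  fixes A :: "'i \<Rightarrow> 'a::topological_space measure" and c :: "'i \<Rightarrow> ennreal"
  assumes I: "finite I" and sets: "\<And>i. i \<in> I \<Longrightarrow> sets (A i) = sets borel"
  obtains N where "sets N = sets borel"
    "\<And>B. B \<in> sets borel \<Longrightarrow> emeasure N B = (\<Sum>i\<in>I. c i * emeasure (A i) B)"
proof
  let ?N = "measure_of UNIV (sets borel) (\<lambda>B. \<Sum>i\<in>I. c i * emeasure (A i) B) :: 'a measure"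
  show s: "sets ?N = sets borel"
    using sets.sigma_sets_eq[of "borel :: 'a measure"] by simp
  show "emeasure ?N B = (\<Sum>i\<in>I. c i * emeasure (A i) B)" if B: "B \<in> sets borel" for B
  proof (rule emeasure_measure_of[OF refl])
    show "countably_additive (sets ?N) (\<lambda>B. \<Sum>i\<in>I. c i * emeasure (A i) B)"
      unfolding countably_additive_def s
    proof (intro allI impI)
      fix X :: "nat \<Rightarrow> 'a set"
      assume X: "range X \<subseteq> sets borel" "disjoint_family X"
      have "(\<Sum>n. \<Sum>i\<in>I. c i * emeasure (A i) (X n)) = (\<Sum>i\<in>I. \<Sum>n. c i * emeasure (A i) (X n))"
        by (rule suminf_sum) simp
      also have "\<dots> = (\<Sum>i\<in>I. c i * emeasure (A i) (\<Union>n. X n))"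
        using X sets by (intro sum.cong refl) (simp add: suminf_emeasure)
      finally show "(\<Sum>n. \<Sum>i\<in>I. c i * emeasure (A i) (X n)) = (\<Sum>i\<in>I. c i * emeasure (A i) (\<Union>n. X n))" .
    qed
  qed (use B s in \<open>auto simp: positive_def\<close>)
qed

text \<open>Both sides of the polynomial identity are rotationally invariant Radon measures. Their
  ball masses agree by linearity of the profile and the multinomial expansion, hence so do the
  measures.\<close>

lemma mixed_MA_on_radial:
  assumes n: "CARD('n) \<ge> 2"
  shows "mixed_MA_on (radial_Conv :: (real^'n \<Rightarrow> real) set) radial_mixed_MA"
  unfolding mixed_MA_on_def
proof (intro conjI allI impI ballI)
  fix us :: "(real^'n \<Rightarrow> real) list"
  assume "set us \<subseteq> radial_Conv \<and> length us = CARD('n)"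
  then show "Radon_measure (radial_mixed_MA us)" by (intro Radon_radial_mixed_MA) simp
next
  fix us vs :: "(real^'n \<Rightarrow> real) list"
  assume "set us \<subseteq> radial_Conv \<and> length us = CARD('n) \<and> mset vs = mset us"
  then have "prod_mset (image_mset f (mset vs)) = prod_mset (image_mset f (mset us))"
    for f :: "_ \<Rightarrow> real" by simp
  then have "(\<Prod>v\<leftarrow>vs. f v) = (\<Prod>v\<leftarrow>us. f v)" for f :: "_ \<Rightarrow> real"
    by (simp add: prod_mset_prod_list flip: mset_map)
  then show "radial_mixed_MA vs = radial_mixed_MA us" by (simp add: radial_mixed_MA_def)
next
  fix m :: nat and w :: "nat \<Rightarrow> real^'n \<Rightarrow> real" and l :: "nat \<Rightarrow> real" and B :: "(real^'n) set"
  assume wl: "\<forall>i\<in>{1..m}. w i \<in> radial_Conv \<and> 0 \<le> l i" and B: "B \<in> sets borel"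
  let ?f = "\<lambda>x. \<Sum>i = 1..m. l i * w i x"
  let ?I = "{is. set is \<subseteq> {1..m} \<and> length is = CARD('n)}"
  let ?c = "\<lambda>is. ennreal (\<Prod>i\<leftarrow>is. l i)"
  let ?\<kappa> = "measure lborel (ball (0::real^'n) 1)"
  have f: "?f \<in> Conv" "radially_symmetric ?f"
    "\<And>r. 0 < r \<Longrightarrow> rprofile ?f r = (\<Sum>i = 1..m. l i * rprofile (w i) r)"
    using rprofile_sum[of "{1..m}" w l] wl by (auto simp: radial_Conv_def)
  have G: "profile (rprofile ?f)" by (rule profile_rprofile[OF f(1,2)])
  have I: "finite ?I" by (intro finite_lists_length_eq) simp
  have w: "set (map w is) \<subseteq> radial_Conv" if "is \<in> ?I" for "is"
    using that wl by auto
  note rot = rotationally_invariant_radial_mixed_MA[OF w]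
    and ball = emeasure_radial_mixed_MA_ball[OF w]
  obtain N where N: "sets N = sets borel"
    "\<And>B. B \<in> sets borel \<Longrightarrow> emeasure N B = (\<Sum>is\<in>?I. ?c is * emeasure (radial_mixed_MA (map w is)) B)"
    by (rule finite_sum_measure_exists[OF I, of "\<lambda>is. radial_mixed_MA (map w is)" ?c])
       (simp_all add: radial_mixed_MA_def)
  have N_ball: "emeasure N (ball 0 r) = ennreal (?\<kappa> * rprofile ?f r ^ CARD('n))" if r: "0 < r" for r
  proof -
    have "emeasure N (ball 0 r) = (\<Sum>is\<in>?I. ?c is * ennreal (?\<kappa> * (\<Prod>i\<leftarrow>is. rprofile (w i) r)))"
      unfolding N(2)[OF borel_open[OF open_ball]]
      using ball[OF _ r] by (intro sum.cong refl) (simp add: comp_def)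
    also have "\<dots> = (\<Sum>is\<in>?I. ennreal (?\<kappa> * (\<Prod>i\<leftarrow>is. l i * rprofile (w i) r)))"
    proof (intro sum.cong refl)
      fix "is" assume "is \<in> ?I"
      then have "0 \<le> (\<Prod>i\<leftarrow>is. l i)" using wl by (intro prod_list_nonneg) auto
      moreover have "(\<Prod>i\<leftarrow>is. l i * rprofile (w i) r) = (\<Prod>i\<leftarrow>is. l i) * (\<Prod>i\<leftarrow>is. rprofile (w i) r)"
        by (induction "is") (simp_all add: mult_ac)
      ultimately show "?c is * ennreal (?\<kappa> * (\<Prod>i\<leftarrow>is. rprofile (w i) r))
          = ennreal (?\<kappa> * (\<Prod>i\<leftarrow>is. l i * rprofile (w i) r))"
        by (simp add: mult_ac flip: ennreal_mult')
    qed
    also have "\<dots> = ennreal (\<Sum>is\<in>?I. ?\<kappa> * (\<Prod>i\<leftarrow>is. l i * rprofile (w i) r))"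
      using wl by (intro sum_ennreal mult_nonneg_nonneg prod_list_nonneg) (auto intro!: mult_nonneg_nonneg rprofile_nonneg)
    also have "(\<Sum>is\<in>?I. ?\<kappa> * (\<Prod>i\<leftarrow>is. l i * rprofile (w i) r))
        = ?\<kappa> * (\<Sum>i = 1..m. l i * rprofile (w i) r) ^ CARD('n)"
      by (simp add: power_sum_eq_sum_lists flip: sum_distrib_left)
    finally show ?thesis using f(3)[OF r] by simp
  qed
  have "radial_measure (rprofile ?f) = N"
  proof (rule radial_Radon_measure_unique[OF n])
    show "Radon_measure (radial_measure (rprofile ?f))" "rotationally_invariant (radial_measure (rprofile ?f))"
      by (rule Radon_measure_radial_measure[OF G] rotationally_invariant_radial_measure[OF G])+
    show "Radon_measure N"
      by (rule Radon_measure_if_balls_finite[OF N(1)]) (simp add: N_ball)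
    show "rotationally_invariant N"
      unfolding rotationally_invariant_def
    proof (intro allI impI ballI)
      fix Q :: "real^'n^'n" and S :: "(real^'n) set"
      assume Q: "rotation_matrix Q" and S: "S \<in> sets borel"
      have "(*v) Q ` S \<in> sets borel"
        using measurable_sets_borel[OF measurable_matrix_vector_mult S]
        by (simp add: rotation_matrix_image[OF Q] del: transpose_matrix_vector)
      then show "emeasure N ((*v) Q ` S) = emeasure N S"
        using rot Q S by (simp add: N(2) rotationally_invariant_def)
    qed
    show "emeasure (radial_measure (rprofile ?f)) (ball (0::real^'n) r) = emeasure N (ball 0 r)"
      if "0 < r" for r
      by (simp only: N_ball[OF that] emeasure_radial_measure_ball[OF G that])
  qed
  then show "MA ?f B = (\<Sum>is\<in>?I. ?c is * emeasure (radial_mixed_MA (map w is)) B)"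
    using MA_radial[OF f(1,2) B] N(2)[OF B] by simp
qed

text \<open>Since the characterization on the entries alone determines \<open>mixed_MA\<close>, it
  coincides with \<open>radial_mixed_MA\<close>, and the measure equation reduces to ball
  masses.\<close>

lemma mixed_MA_radial_eq_iff:
  fixes us :: "(real^'n \<Rightarrow> real) list"
  assumes n: "CARD('n) \<ge> 2" and us: "set us \<subseteq> radial_Conv" "length us = CARD('n)"
    and \<mu>: "Radon_measure \<mu>" "rotationally_invariant \<mu>"
  shows "mixed_MA us = \<mu> \<longleftrightarrow> (\<forall>r>0. emeasure \<mu> (ball 0 r)
    = ennreal (measure lborel (ball (0::real^'n) 1) * (\<Prod>v\<leftarrow>us. rprofile v r)))"
proof -
  have "mixed_MA us = radial_mixed_MA us"
    by (rule mixed_MA_eq[OF mixed_MA_on_mono[OF mixed_MA_on_radial[OF n] us(1)] us(2)])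
  then show ?thesis
    using radial_Radon_measure_unique[OF n Radon_radial_mixed_MA[OF us(1)] \<mu>(1)
        rotationally_invariant_radial_mixed_MA[OF us(1)] \<mu>(2)]
      emeasure_radial_mixed_MA_ball[OF us(1)] by metis
qed

section \<open>Recovering a radial function from its profile\<close>

text \<open>Over \<open>N\<close> equal subintervals the bounds telescope to
  \<open>(G R - G 0) * R / N\<close>, which tends to 0. This replaces differentiation, which fails
  where a profile jumps.\<close>

lemma eq_if_increment_bound_mono:
  fixes f G :: "real \<Rightarrow> real"
  assumes R: "0 \<le> R"
    and bound: "\<And>a b. 0 \<le> a \<Longrightarrow> a \<le> b \<Longrightarrow> b \<le> R \<Longrightarrow> \<bar>f b - f a\<bar> \<le> (G b - G a) * (b - a)"
  shows "f R = f 0"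
proof -
  have le: "\<bar>f R - f 0\<bar> * real N \<le> (G R - G 0) * R" if N: "0 < N" for N :: nat
  proof -
    define a where "a i = real i * R / real N" for i
    have a: "0 \<le> a i" "a i \<le> a (Suc i)" "a (Suc i) - a i = R / real N" for i
      using R N by (simp_all add: a_def field_simps)
    have aR: "a (Suc i) \<le> R" if "i < N" for i
      using mult_left_mono[of "real (Suc i)" "real N" R] that R N by (simp add: a_def field_simps)
    have "f R - f 0 = (\<Sum>i<N. f (a (Suc i)) - f (a i))"
      using N by (subst sum_lessThan_telescope) (simp add: a_def)
    then have "\<bar>f R - f 0\<bar> \<le> (\<Sum>i<N. \<bar>f (a (Suc i)) - f (a i)\<bar>)"
      by simp
    also have "\<dots> \<le> (\<Sum>i<N. (G (a (Suc i)) - G (a i)) * (R / real N))"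
      using bound[OF a(1,2) aR] by (intro sum_mono) (simp add: a(3))
    also have "\<dots> = (\<Sum>i<N. G (a (Suc i)) - G (a i)) * (R / real N)"
      by (simp only: sum_distrib_right)
    also have "\<dots> = (G R - G 0) * (R / real N)"
      using N by (subst sum_lessThan_telescope) (simp add: a_def)
    finally show ?thesis using N by (simp add: field_simps)
  qed
  show ?thesis
  proof (rule ccontr)
    assume "f R \<noteq> f 0"
    then have pos: "0 < \<bar>f R - f 0\<bar>" by simp
    obtain N :: nat where "(G R - G 0) * R < real N * \<bar>f R - f 0\<bar>"
      using reals_Archimedean3[OF pos] by blast
    moreover have "real N * \<bar>f R - f 0\<bar> \<le> real (Suc N) * \<bar>f R - f 0\<bar>"
      by (intro mult_right_mono) auto
    ultimately show False using le[of "Suc N"] by (simp add: mult.commute)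
  qed
qed

text \<open>These are the bounds of \<open>rprofile_increment_bounds\<close> for the integral, which
  makes the two increments comparable.\<close>

lemma integral_increment_bounds:
  fixes g :: "real \<Rightarrow> real"
  assumes g: "mono_on {0..} g" and ab: "0 \<le> a" "a \<le> b"
  shows "g a * (b - a) \<le> integral {0..b} g - integral {0..a} g"
    and "integral {0..b} g - integral {0..a} g \<le> g b * (b - a)"
proof -
  have int: "g integrable_on {c..d}" if "0 \<le> c" for c d
    using that by (intro integrable_on_mono_on monotone_on_subset[OF g]) auto
  have eq: "integral {0..b} g - integral {0..a} g = integral {a..b} g"
    using Henstock_Kurzweil_Integration.integral_combine[OF ab int[of 0 b]] by simp
  have "integral {a..b} (\<lambda>_. g a) \<le> integral {a..b} g"
    using ab by (intro integral_le int integrable_const_ivl) (auto intro: mono_onD[OF g])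
  then show "g a * (b - a) \<le> integral {0..b} g - integral {0..a} g"
    using ab by (simp add: eq mult.commute)
  have "integral {a..b} g \<le> integral {a..b} (\<lambda>_. g b)"
    using ab by (intro integral_le int integrable_const_ivl) (auto intro: mono_onD[OF g])
  then show "integral {0..b} g - integral {0..a} g \<le> g b * (b - a)"
    using ab by (simp add: eq mult.commute)
qed

text \<open>Increments of \<open>v\<close> along a ray and of the integral lie between the same two
  bounds, so \<open>eq_if_increment_bound_mono\<close> applies to their difference.\<close>

lemma radial_eq_integral_rprofile:
  fixes v :: "real^'n \<Rightarrow> real"
  assumes v: "v \<in> Conv" "radially_symmetric v" and v0: "v 0 = 0"
  shows "v x = integral {0..norm x} (rprofile v)"
proof -
  define e :: "real^'n" where "e = axis undefined 1"
  have e: "norm e = 1" by (simp add: e_def)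
  have mono: "mono_on {0..} (rprofile v)"
    by (intro mono_onI rprofile_mono[OF v])
  define f where "f t = v (t *\<^sub>R e) - integral {0..t} (rprofile v)" for t
  have "f (norm x) = f 0"
  proof (rule eq_if_increment_bound_mono)
    show "\<bar>f b - f a\<bar> \<le> (rprofile v b - rprofile v a) * (b - a)" if "0 \<le> a" "a \<le> b" for a b
      using rprofile_increment_bounds[OF v e that] integral_increment_bounds[OF mono that]
      unfolding f_def abs_le_iff left_diff_distrib by linarith
  qed simp
  moreover have "v (norm x *\<^sub>R e) = v x"
    by (rule radially_symmetricD[OF v(2)]) (simp add: e)
  ultimately show ?thesis using v0 by (simp add: f_def)
qed

text \<open>The affine minorant touching \<open>u\<close> at a convex combination lies below
  \<open>u\<close> at both endpoints.\<close>

lemma Conv_if_subgradients: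
  fixes u :: "real^'n \<Rightarrow> real"
  assumes "\<And>x. subdifferential u x \<noteq> {}"
  shows "u \<in> Conv"
  unfolding Conv_def
proof (intro CollectI convex_onI)
  fix t :: real and x y :: "real^'n"
  assume t: "0 < t" "t < 1"
  define z where "z = (1 - t) *\<^sub>R x + t *\<^sub>R y"
  obtain p where p: "p \<in> subdifferential u z" using assms by blast
  have "(1 - t) * (u z + p \<bullet> (x - z)) + t * (u z + p \<bullet> (y - z)) = u z + p \<bullet> ((1 - t) *\<^sub>R x + t *\<^sub>R y - z)"
    by (simp add: inner_diff_right inner_add_right algebra_simps)
  also have "\<dots> = u z" by (simp add: z_def)
  finally have "u z = (1 - t) * (u z + p \<bullet> (x - z)) + t * (u z + p \<bullet> (y - z))" ..
  also have "\<dots> \<le> (1 - t) * u x + t * u y"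
    using t by (intro add_mono mult_left_mono subdifferentialD[OF p]) auto
  finally show "u ((1 - t) *\<^sub>R x + t *\<^sub>R y) \<le> (1 - t) * u x + t * u y" by (simp add: z_def)
qed simp

text \<open>The vector of length \<open>g (norm x)\<close> in direction \<open>x\<close> is a
  subgradient at \<open>x\<close>. The condition \<open>g 0 = 0\<close> makes this correct at the
  origin, where \<open>sgn\<close> vanishes, and extends monotonicity to radius 0.\<close>

lemma radial_integral:
  fixes g :: "real \<Rightarrow> real"
  defines "u \<equiv> \<lambda>x :: real^'n. integral {0..norm x} g"
  assumes g: "profile g" "g 0 = 0"
  shows "u \<in> Conv" "radially_symmetric u" "0 < r \<Longrightarrow> rprofile u r = g r"
proof -
  have g_nonneg: "0 \<le> g r" if "0 \<le> r" for r
    using profile_nonneg[OF g(1), of r] g(2) that by (cases "r = 0") auto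
  have mono: "mono_on {0..} g"
  proof (rule mono_onI)
    fix r s :: real assume "r \<in> {0..}" "s \<in> {0..}" "r \<le> s"
    then show "g r \<le> g s"
      using profile_mono[OF g(1), of r s] g(2) g_nonneg[of s] by (cases "r = 0") auto
  qed
  show rad: "radially_symmetric u" by (simp add: u_def radially_symmetric_def)
  have support: "u x + g (norm x) * (norm z - norm x) \<le> u z" for x z :: "real^'n"
  proof (cases "norm x \<le> norm z")
    case True
    then show ?thesis
      using integral_increment_bounds(1)[OF mono norm_ge_zero, of x "norm z"] by (simp add: u_def)
  next
    case False
    then show ?thesis
      using integral_increment_bounds(2)[OF mono norm_ge_zero, of z "norm x"]
      by (simp add: u_def algebra_simps)
  qed
  have sub: "g (norm x) *\<^sub>R sgn x \<in> subdifferential u x" for x :: "real^'n"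
  proof (rule radial_subgradientI)
    have *: "norm (g (norm x) *\<^sub>R sgn x) = g (norm x)"
      using g(2) by (cases "x = 0") (simp_all add: norm_sgn g_nonneg)
    show "(g (norm x) *\<^sub>R sgn x) \<bullet> x = norm (g (norm x) *\<^sub>R sgn x) * norm x"
      unfolding * by (simp add: inner_commute[of _ x] inner_sgn_self)
    show "u x + norm (g (norm x) *\<^sub>R sgn x) * (norm z - norm x) \<le> u z" for z
      unfolding * by (rule support)
  qed
  show conv: "u \<in> Conv" by (rule Conv_if_subgradients) (use sub in blast)
  assume r: "0 < r"
  show "rprofile u r = g r"
  proof (rule antisym)
    show "rprofile u r \<le> g r"
    proof (rule rprofile_least[OF g_nonneg])
      fix x p assume x: "norm x < r" and p: "p \<in> subdifferential u x"
      \<comment> \<open>The subgradient inequality of \<open>p\<close> tested at radius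
        \<open>r\<close>, together with the support inequality there, yields the bound by
        \<open>g r\<close>.\<close>
      define z :: "real^'n" where "z = r *\<^sub>R axis undefined 1"
      have z: "norm z = r" using r by (simp add: z_def)
      have "norm p * (r - norm x) \<le> g r * (r - norm x)"
        using radial_subgradient_ineq[OF rad p, of z] support[of z x]
        by (simp add: z algebra_simps)
      then show "norm p \<le> g r" using x by simp
    qed (use r in simp)
    show "g r \<le> rprofile u r"
    proof (rule ccontr)
      assume "\<not> ?thesis"
      then have less: "rprofile u r < g r" by simp
      \<comment> \<open>Left continuity of \<open>g\<close> supplies a radius strictly inside, whose
        subgradient counts for \<open>rprofile u r\<close>.\<close>
      obtain a where a: "0 < a" "a < r" "rprofile u r < g a"
        using profile_left_approx[OF g(1) r less] by blast
      define x :: "real^'n" where "x = a *\<^sub>R axis undefined 1"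
      have x: "norm x = a" "x \<noteq> 0" using a(1) by (auto simp: x_def axis_eq_0_iff)
      have "norm (g (norm x) *\<^sub>R sgn x) \<le> rprofile u r"
        using x a by (intro rprofile_upper[OF conv rad _ sub]) simp
      then show False using a x by (simp add: norm_sgn g_nonneg)
    qed
  qed
qed

text \<open>An open ball is the increasing union of smaller concentric open balls, so its mass is
  left-continuous in the radius.\<close>

lemma profile_emeasure_ball:
  fixes \<mu> :: "(real^'n) measure"
  assumes \<mu>: "Radon_measure \<mu>"
  shows "emeasure \<mu> (ball 0 r) = ennreal (measure \<mu> (ball 0 r))"
    and "profile (\<lambda>r. measure \<mu> (ball 0 r))"
proof -
  have sets [simp]: "sets \<mu> = sets borel" using \<mu> by (simp add: Radon_measure_def)
  have fin: "emeasure \<mu> (ball 0 r) \<noteq> \<infinity>" for r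
  proof -
    have "emeasure \<mu> (ball 0 r) \<le> emeasure \<mu> (cball 0 r)" by (intro emeasure_mono) auto
    also have "\<dots> < \<infinity>" using \<mu> by (auto simp: Radon_measure_def)
    finally show ?thesis by simp
  qed
  show em: "emeasure \<mu> (ball 0 r) = ennreal (measure \<mu> (ball 0 r))" for r
    using fin[of r] by (simp add: emeasure_eq_ennreal_measure)
  show "profile (\<lambda>r. measure \<mu> (ball 0 r))"
  proof (rule profileI)
    fix r s :: real assume "r \<le> s"
    then have "emeasure \<mu> (ball 0 r) \<le> emeasure \<mu> (ball 0 s)" by (intro emeasure_mono) auto
    then show "measure \<mu> (ball 0 r) \<le> measure \<mu> (ball 0 s)" by (simp add: em)
  next
    fix r s :: real assume r: "0 < r" and s: "s < measure \<mu> (ball 0 r)"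
    \<comment> \<open>The denominators start at 2 so that \<open>d 0\<close> is positive.\<close>
    define d where "d i = r - r / (real i + 2)" for i
    have d: "0 < d i" "d i < r" for i
      using r by (simp_all add: d_def field_simps add_pos_nonneg)
    have inc: "d i \<le> d j" if "i \<le> j" for i j
      using that r unfolding d_def by (intro diff_left_mono divide_left_mono) auto
    have lim: "d \<longlonglongrightarrow> r - 0"
      unfolding d_def by (intro tendsto_diff tendsto_const real_tendsto_divide_at_top[OF tendsto_const])
        (intro filterlim_tendsto_add_at_top[OF tendsto_const, of _ _ 2, simplified add.commute] filterlim_real_sequentially)
    have "(\<Union>i. ball 0 (d i)) = ball (0::real^'n) r"
    proof (intro equalityI subsetI)
      fix x :: "real^'n" assume "x \<in> ball 0 r"
      then have "eventually (\<lambda>i. norm x < d i) sequentially"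
        using order_tendstoD(1)[OF lim, of "norm x"] by simp
      then obtain i where "norm x < d i" using eventually_happens by fastforce
      then show "x \<in> (\<Union>i. ball 0 (d i))" by auto
    qed (use d(2) less_trans in fastforce)
    moreover have "(SUP i. emeasure \<mu> (ball 0 (d i))) = emeasure \<mu> (\<Union>i. ball 0 (d i))"
      by (intro SUP_emeasure_incseq) (auto simp: incseq_def intro: less_le_trans[OF _ inc])
    ultimately have sup: "(SUP i. emeasure \<mu> (ball 0 (d i))) = ennreal (measure \<mu> (ball 0 r))"
      by (simp add: em)
    show "\<exists>r'>0. r' < r \<and> s < measure \<mu> (ball 0 r')"
    proof (cases "0 \<le> s")
      case True
      then have "ennreal s < (SUP i. emeasure \<mu> (ball 0 (d i)))"
        using s by (simp add: sup ennreal_less_iff)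
      then obtain i where "ennreal s < emeasure \<mu> (ball 0 (d i))" by (auto simp: less_SUP_iff)
      then show ?thesis using True d[of i] by (auto simp: em ennreal_less_iff)
    next
      case False
      then show ?thesis using d[of 0] measure_nonneg[of \<mu> "ball 0 (d 0)"]
        by (intro exI[of _ "d 0"]) linarith
    qed
  qed simp
qed

section \<open>Reduction of the measure equation to an equation between profiles\<close>

theorem theorem3p5:
  fixes \<mu> :: "(real^'n) measure" and us :: "(real^'n \<Rightarrow> real) list" and k :: nat
  assumes "CARD('n) \<ge> 2"
    and "Radon_measure \<mu>" and "rotationally_invariant \<mu>"
    and "1 \<le> k" and "k \<le> CARD('n)"
    and "length us = CARD('n) - k"
    and "\<forall>v\<in>set us. v \<in> Conv \<and> radially_symmetric v \<and> (\<forall>r>0. 0 < psup v r \<and> psup v r < \<infinity>)"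
  shows "((\<exists>!u. solves k us \<mu> u) \<longleftrightarrow> mono_on {0<..} (F \<mu> us)) \<and>
    (mono_on {0<..} (F \<mu> us) \<longrightarrow>
      (\<forall>u. solves k us \<mu> u \<longrightarrow>
        (\<forall>x. u x = integral {0..norm x}
                     (\<lambda>t. (enn2real (F \<mu> us t) / measure lborel (ball (0::real^'n) 1))
                            powr (1 / real k)))))"
proof -
  define \<kappa> where "\<kappa> = measure lborel (ball (0::real^'n) 1)"
  define m where "m r = measure \<mu> (ball 0 r)" for r
  define P where "P r = (\<Prod>v\<leftarrow>us. rprofile v r)" for r
  define g where "g t = (enn2real (F \<mu> us t) / \<kappa>) powr (1 / real k)" for t
  have \<kappa>: "0 < \<kappa>" unfolding \<kappa>_def by (rule content_ball_pos) simp
  have k: "0 < k" using assms(4) by simp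
  have us: "set us \<subseteq> radial_Conv" using assms(7) by (auto simp: radial_Conv_def)
  have psup: "psup v r = ennreal (rprofile v r)" if "v \<in> set us" for v r
    using that assms(7) by (intro psup_eq_rprofile) auto
  have P_pos: "0 < P r" if r: "0 < r" for r
  proof -
    have "0 < rprofile v r" if v: "v \<in> set us" for v
      using assms(7) v r psup[OF v, of r] by (metis ennreal_less_zero_iff)
    then show ?thesis unfolding P_def by (induction us) auto
  qed
  have m: "emeasure \<mu> (ball 0 r) = ennreal (m r)" "0 \<le> m r" for r
    using profile_emeasure_ball(1)[OF assms(2)] by (auto simp: m_def)
  have psup_prod: "(\<Prod>v\<leftarrow>us. psup v r) = ennreal (P r)" for r
  proof -
    have "(\<Prod>v\<leftarrow>us. psup v r) = (\<Prod>v\<leftarrow>us. ennreal (rprofile v r))"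
      by (intro arg_cong[where f = prod_list] map_cong refl psup)
    also have "\<dots> = ennreal (P r)"
      unfolding P_def by (induction us) (simp_all add: rprofile_nonneg ennreal_mult')
    finally show ?thesis .
  qed
  have F: "F \<mu> us r = ennreal (m r / P r)" if "0 < r" for r
    using P_pos[OF that] by (simp add: F_def m psup_prod divide_ennreal)
  \<comment> \<open>\<open>powr\<close> and \<open>root\<close> also agree at base 0, where both
    give 0; this case is split off because \<open>root_powr_inverse\<close> requires a positive
    base.\<close>
  have g_pos: "g r = root k (m r / P r / \<kappa>)" if r: "0 < r" for r
  proof -
    have "0 \<le> m r / P r / \<kappa>" using m(2)[of r] P_pos[OF r] \<kappa> by simp
    then show ?thesis
      using F[OF r] P_pos[OF r] m(2)[of r] k root_powr_inverse[of k "m r / P r / \<kappa>"]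
      by (cases "m r / P r / \<kappa> = 0") (auto simp: g_def)
  qed
  \<comment> \<open>\<open>ball 0 0\<close> is empty, and in \<open>ennreal\<close> zero divided by
    anything, even by zero, is zero.\<close>
  have "F \<mu> us 0 = 0" by (simp add: F_def)
  then have g0: "g 0 = 0" by (simp add: g_def)
  \<comment> \<open>The \<open>k\<close> equal entries contribute \<open>rprofile u r ^ k\<close> to
    the mass of the ball of radius \<open>r\<close>, so the measure equation prescribes this power
    and thereby the profile of \<open>u\<close>.\<close>
  have solves_iff: "solves k us \<mu> u \<longleftrightarrow>
      u \<in> Conv \<and> radially_symmetric u \<and> u 0 = 0 \<and> (\<forall>r>0. rprofile u r = g r)" for u
  proof -
    have "mixed_MA (replicate k u @ us) = \<mu> \<longleftrightarrow> (\<forall>r>0. rprofile u r = g r)"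
      if u: "u \<in> Conv" "radially_symmetric u"
    proof -
      have "set (replicate k u @ us) \<subseteq> radial_Conv" "length (replicate k u @ us) = CARD('n)"
        using u us assms(5,6) by (auto simp: radial_Conv_def)
      then have "mixed_MA (replicate k u @ us) = \<mu> \<longleftrightarrow>
          (\<forall>r>0. ennreal (m r) = ennreal (\<kappa> * (rprofile u r ^ k * P r)))"
        using mixed_MA_radial_eq_iff[OF assms(1) _ _ assms(2,3), of "replicate k u @ us"]
        by (simp add: m \<kappa>_def P_def)
      also have "\<dots> \<longleftrightarrow> (\<forall>r>0. rprofile u r = g r)"
      proof (intro all_cong1 imp_cong refl)
        fix r :: real assume r: "0 < r"
        have "ennreal (m r) = ennreal (\<kappa> * (rprofile u r ^ k * P r)) \<longleftrightarrow> m r = \<kappa> * (rprofile u r ^ k * P r)"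
          using m(2) \<kappa> P_pos[OF r] rprofile_nonneg[of u r] by simp
        also have "\<dots> \<longleftrightarrow> rprofile u r ^ k = m r / P r / \<kappa>"
          using \<kappa> P_pos[OF r] by (auto simp: field_simps)
        \<comment> \<open>Nonnegativity of \<open>rprofile\<close> makes the root unique, also for
          even \<open>k\<close>.\<close>
        also have "\<dots> \<longleftrightarrow> rprofile u r = root k (m r / P r / \<kappa>)"
          using k rprofile_nonneg[of u r] m(2)[of r] \<kappa> P_pos[OF r]
          by (metis divide_nonneg_pos real_root_pos2 real_root_pow_pos2)
        finally show "ennreal (m r) = ennreal (\<kappa> * (rprofile u r ^ k * P r)) \<longleftrightarrow> rprofile u r = g r"
          by (simp only: g_pos[OF r])
      qed
      finally show ?thesis .
    qed
    then show ?thesis unfolding solves_def by blast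
  qed
  have formula: "u x = integral {0..norm x} g" if "solves k us \<mu> u" for u x
  proof -
    have u: "u \<in> Conv" "radially_symmetric u" "u 0 = 0" "\<And>r. 0 < r \<Longrightarrow> rprofile u r = g r"
      using that by (auto simp: solves_iff)
    have "u x = integral {0..norm x} (rprofile u)"
      by (rule radial_eq_integral_rprofile[OF u(1-3)])
    also have "\<dots> = integral {0..norm x} g"
    proof (rule integral_cong)
      show "rprofile u t = g t" if "t \<in> {0..norm x}" for t
        using u(4)[of t] g0 that by (cases "t = 0") auto
    qed
    finally show ?thesis .
  qed
  \<comment> \<open>The profile of a solution is nondecreasing, and the root and the positive factor
    can be cancelled from the inequality.\<close>
  have mono: "mono_on {0<..} (F \<mu> us)" if sol: "solves k us \<mu> u" for u
  proof (rule mono_onI)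
    fix r s :: real assume rs: "r \<in> {0<..}" "s \<in> {0<..}" "r \<le> s"
    have "g r \<le> g s"
      using sol rs rprofile_mono[of u r s] by (simp add: solves_iff)
    then have "m r / P r \<le> m s / P s"
      using rs k \<kappa> by (simp add: g_pos divide_le_cancel del: divide_divide_eq_left)
    then show "F \<mu> us r \<le> F \<mu> us s" using rs by (simp add: F ennreal_leI)
  qed
  \<comment> \<open>Left continuity of the quotient comes from that of \<open>m\<close> and
    \<open>P\<close> with \<open>P\<close> positive; monotonicity is the hypothesis. Hence
    \<open>g\<close> is a profile and its integral a solution.\<close>
  have exists: "\<exists>u. solves k us \<mu> u" if mono: "mono_on {0<..} (F \<mu> us)"
  proof -
    have "profile (\<lambda>r. m r / P r / \<kappa>)"
      unfolding profile_def
    proof (intro conjI allI impI mono_onI)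
      fix r s :: real assume rs: "r \<in> {0<..}" "s \<in> {0<..}" "r \<le> s"
      have "ennreal (m r / P r) \<le> ennreal (m s / P s)"
        using mono_onD[OF mono rs] rs by (simp add: F)
      then have "m r / P r \<le> m s / P s"
        using m(2)[of s] P_pos[of s] rs by simp
      then show "m r / P r / \<kappa> \<le> m s / P s / \<kappa>"
        using \<kappa> by (intro divide_right_mono) auto
    next
      fix r :: real assume r: "0 < r"
      show "0 \<le> m r / P r / \<kappa>" using m(2)[of r] P_pos[OF r] \<kappa> by simp
      have "(m \<longlongrightarrow> m r) (at_left r)"
        using profile_emeasure_ball(2)[OF assms(2)] r by (simp add: profile_def m_def[abs_def])
      moreover have "(P \<longlongrightarrow> P r) (at_left r)"
        using profile_prod_rprofile[OF us] r by (simp add: profile_def P_def[abs_def])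
      ultimately show "((\<lambda>r. m r / P r / \<kappa>) \<longlongrightarrow> m r / P r / \<kappa>) (at_left r)"
        using \<kappa> P_pos[OF r] by (intro tendsto_intros) auto
    qed
    then have root: "profile (\<lambda>r. root k (m r / P r / \<kappa>))" by (rule profile_root[OF _ k])
    \<comment> \<open>\<open>g\<close> is known to equal the root only at positive radii, the only
      ones in the conditions of \<open>profileI\<close>.\<close>
    have "profile g"
    proof (rule profileI)
      show "g r \<le> g s" if "0 < r" "r \<le> s" for r s
        using profile_mono[OF root that] that by (simp add: g_pos)
      show "0 \<le> g r" for r by (simp add: g_def)
      show "\<exists>r'>0. r' < r \<and> s < g r'" if r: "0 < r" and s: "s < g r" for r s
        using profile_left_approx[OF root r, of s] s r by (metis g_pos)
    qed
    note u = radial_integral[OF this g0, where 'n = 'n]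
    have "solves k us \<mu> (\<lambda>x. integral {0..norm x} g)"
      unfolding solves_iff using u by simp
    then show ?thesis by blast
  qed
  have "(\<exists>!u. solves k us \<mu> u) \<longleftrightarrow> mono_on {0<..} (F \<mu> us)"
  proof
    assume "mono_on {0<..} (F \<mu> us)"
    then obtain u where u: "solves k us \<mu> u" using exists by blast
    \<comment> \<open>Uniqueness follows from the formula: every solution is the integral of the
      same \<open>g\<close>.\<close>
    have "v = u" if "solves k us \<mu> v" for v
      using formula[OF that] formula[OF u] by (intro ext) simp
    with u show "\<exists>!u. solves k us \<mu> u" by blast
  qed (use mono in blast)
  then show ?thesis
    using formula by (simp add: g_def[abs_def] \<kappa>_def)
qed

end
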